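(* Let $k$ be a field, $R=k[x_1,\ldots,x_d]$, $T=k[y_1,\ldots,y_n]$, and $B=R\otimes_k T$, bigraded by $\operatorname{bideg} x_i=(1,0)$ and $\operatorname{bideg} y_i=(0,1)$. Let $\mathfrak m=(x_1,\ldots,x_d)$ and let $f_1,\ldots,f_d\in\mathfrak m B$ be a $B$-regular sequence of bihomogeneous elements with $\operatorname{bideg} f_i=(\alpha_i,\beta_i)$. Let $\mathcal S=B/(f_1,\ldots,f_d)$. Then there is a bihomogeneous isomorphism of $B$-modules $$H^0_{\mathfrak m}(\mathcal S)\;\cong\;\operatorname{Hom}_T(\mathcal S,T)(-\delta,-\tau),$$ where $\delta=\left(\sum_{i=1}^d\alpha_i\right)-d$ and $\tau=\sum_{i=1}^d\beta_i$.
   Context: $H^0_{\mathfrak m}(\mathcal S)$ is the zeroth local cohomology module of $\mathcal S$ with respect to $\mathfrak m$, i.e. the elements of $\mathcal S$ annihilated by a power of $\mathfrak m$. For a bigraded module $M$, $M(a,b)$ denotes the shifted module with $M(a,b)_{(i,j)}=M_{(a+i,b+j)}$. $\operatorname{Hom}_T(M,T)$ for a bigraded $B$-module $M$ is the graded $\operatorname{Hom}$: $T$ is viewed as bigraded and concentrated in $x$-degree $0$, and a homomorphism has bidegree $(a,b)$ if it maps $M_{(i,j)}$ to $T_{(i+a,j+b)}$; in particular such a map is zero on $M_{(i,* )}$ for $i\neq -a$. The $B$-module structure is through the argument $M$. *)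

theory Defs
  imports "HOL-Library.Poly_Mapping" "HOL-Algebra.Module" "HOL-Algebra.QuotRing"
    "HOL-Algebra.Ideal_Product"
begin

text \<open>A record with the signature of a bigraded module: \<open>homog M i j\<close> is the component of
  bidegree \<open>(i, j)\<close>. For records used only as modules the fields \<open>mult\<close> and \<open>one\<close>, inherited
  through the record of modules, are irrelevant.\<close>

record ('a, 'm) bigraded = "('a, 'm) module" +
  homog :: "int \<Rightarrow> int \<Rightarrow> 'm set"

definition shift :: "int \<Rightarrow> int \<Rightarrow> ('a, 'm) bigraded \<Rightarrow> ('a, 'm) bigraded" where
  "shift a b M = M\<lparr>homog := (\<lambda>i j. homog M (a + i) (b + j))\<rparr>"

definition bihomogeneous_iso ::
    "('a, 'c) ring_scheme \<Rightarrow> ('a, 'm) bigraded \<Rightarrow> ('a, 'n) bigraded \<Rightarrow> ('m \<Rightarrow> 'n) set" where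
  "bihomogeneous_iso A M N = {\<phi> \<in> iso (add_monoid M) (add_monoid N).
     (\<forall>a \<in> carrier A. \<forall>m \<in> carrier M. \<phi> (a \<odot>\<^bsub>M\<^esub> m) = a \<odot>\<^bsub>N\<^esub> \<phi> m) \<and>
     (\<forall>i j. \<phi> ` homog M i j = homog N i j)}"


section \<open>Polynomial rings\<close>

datatype var = Xv nat | Yv nat

type_synonym 'k mpoly = "(var \<Rightarrow>\<^sub>0 nat) \<Rightarrow>\<^sub>0 'k"

definition xdeg :: "(var \<Rightarrow>\<^sub>0 nat) \<Rightarrow> nat" where
  "xdeg m = (\<Sum>v \<in> Poly_Mapping.keys m. case v of Xv i \<Rightarrow> Poly_Mapping.lookup m v | Yv j \<Rightarrow> 0)"

definition ydeg :: "(var \<Rightarrow>\<^sub>0 nat) \<Rightarrow> nat" where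
  "ydeg m = (\<Sum>v \<in> Poly_Mapping.keys m. case v of Xv i \<Rightarrow> 0 | Yv j \<Rightarrow> Poly_Mapping.lookup m v)"

definition mpolys :: "var set \<Rightarrow> 'k::field mpoly set" where
  "mpolys V = {p. \<forall>m \<in> Poly_Mapping.keys p. Poly_Mapping.keys m \<subseteq> V}"

text \<open>The polynomial ring in the variables \<open>V\<close>, bigraded and regarded as a module over itself.\<close>

definition poly_ring :: "var set \<Rightarrow> ('k::field mpoly, 'k mpoly) bigraded" where
  "poly_ring V =
    \<lparr>carrier = mpolys V, mult = (*), one = 1, zero = 0, add = (+), smult = (*),
     homog = (\<lambda>i j. {p \<in> mpolys V. \<forall>m \<in> Poly_Mapping.keys p. int (xdeg m) = i \<and> int (ydeg m) = j})\<rparr>"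

text \<open>The rings \<open>R = k[x\<^sub>1, \<dots>, x\<^sub>d]\<close>, \<open>T = k[y\<^sub>1, \<dots>, y\<^sub>n]\<close> and
  \<open>B = R \<otimes>\<^sub>k T = k[x\<^sub>1, \<dots>, x\<^sub>d, y\<^sub>1, \<dots>, y\<^sub>n]\<close>, with \<open>R\<close> and \<open>T\<close> realised as subrings of \<open>B\<close>;
  indices start at 0.\<close>

definition Rx :: "nat \<Rightarrow> ('k::field mpoly, 'k mpoly) bigraded" where
  "Rx d = poly_ring (Xv ` {..<d})"

definition Ty :: "nat \<Rightarrow> ('k::field mpoly, 'k mpoly) bigraded" where
  "Ty n = poly_ring (Yv ` {..<n})"

definition Bxy :: "nat \<Rightarrow> nat \<Rightarrow> ('k::field mpoly, 'k mpoly) bigraded" where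
  "Bxy d n = poly_ring (Xv ` {..<d} \<union> Yv ` {..<n})"

definition x_ideal :: "nat \<Rightarrow> 'k::field mpoly set" where
  "x_ideal d = Idl\<^bsub>Rx d\<^esub> ((\<lambda>i. Poly_Mapping.single (Poly_Mapping.single (Xv i) 1) 1) ` {..<d})"


section \<open>Regular sequences, quotients, local cohomology and graded Hom\<close>

definition regular_sequence :: "('a, 'c) ring_scheme \<Rightarrow> nat \<Rightarrow> (nat \<Rightarrow> 'a) \<Rightarrow> bool" where
  "regular_sequence A r f \<longleftrightarrow>
     f ` {..<r} \<subseteq> carrier A \<and>
     (\<forall>i<r. let J = Idl\<^bsub>A\<^esub> (f ` {..<i}) in
        \<forall>s \<in> carrier (A Quot J).
          (J +>\<^bsub>A\<^esub> f i) \<otimes>\<^bsub>A Quot J\<^esub> s = \<zero>\<^bsub>A Quot J\<^esub> \<longrightarrow> s = \<zero>\<^bsub>A Quot J\<^esub>) \<and>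
     Idl\<^bsub>A\<^esub> (f ` {..<r}) \<noteq> carrier A"

text \<open>The quotient ring \<open>A/I\<close> as a bigraded \<open>A\<close>-module, for a bihomogeneous ideal \<open>I\<close>.\<close>

definition quot_bigraded :: "('a, 'a) bigraded \<Rightarrow> 'a set \<Rightarrow> ('a, 'a set) bigraded" where
  "quot_bigraded A I =
    \<lparr>carrier = carrier (A Quot I), mult = mult (A Quot I), one = one (A Quot I),
     zero = zero (A Quot I), add = add (A Quot I),
     smult = (\<lambda>a s. (I +>\<^bsub>A\<^esub> a) \<otimes>\<^bsub>A Quot I\<^esub> s),
     homog = (\<lambda>i j. (\<lambda>p. I +>\<^bsub>A\<^esub> p) ` homog A i j)\<rparr>"

text \<open>\<open>H\<^sup>0\<^sub>I(M)\<close> for an ideal \<open>I\<close> of \<open>A\<close>; the scalars acting on \<open>M\<close> may form a larger ring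
  than \<open>A\<close>. The power of \<open>I\<close> is taken with respect to the product of ideals.\<close>

definition local_cohomology0 ::
    "('a, 'c) ring_scheme \<Rightarrow> 'a set \<Rightarrow> ('a, 'm) bigraded \<Rightarrow> ('a, 'm) bigraded" where
  "local_cohomology0 A I M =
    (let H = {s \<in> carrier M.
                \<exists>N::nat. \<forall>a \<in> I [^]\<^bsub>ideals_set A\<^esub> N. a \<odot>\<^bsub>M\<^esub> s = \<zero>\<^bsub>M\<^esub>}
     in M\<lparr>carrier := H, homog := (\<lambda>i j. homog M i j \<inter> H)\<rparr>)"

text \<open>Homomorphisms are taken extensional, so that they are determined by their values
  on \<open>carrier M\<close>.\<close>

definition lin_maps ::
    "('a, 'c) ring_scheme \<Rightarrow> ('a, 'm) bigraded \<Rightarrow> ('a, 'n) bigraded \<Rightarrow> ('m \<Rightarrow> 'n) set" where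
  "lin_maps A M N = {h \<in> carrier M \<rightarrow>\<^sub>E carrier N.
     (\<forall>u \<in> carrier M. \<forall>v \<in> carrier M. h (u \<oplus>\<^bsub>M\<^esub> v) = h u \<oplus>\<^bsub>N\<^esub> h v) \<and>
     (\<forall>a \<in> carrier A. \<forall>u \<in> carrier M. h (a \<odot>\<^bsub>M\<^esub> u) = a \<odot>\<^bsub>N\<^esub> h u)}"

definition bihom_maps ::
    "('a, 'c) ring_scheme \<Rightarrow> ('a, 'm) bigraded \<Rightarrow> ('a, 'n) bigraded \<Rightarrow> int \<Rightarrow> int \<Rightarrow> ('m \<Rightarrow> 'n) set"
  where
  "bihom_maps A M N a b =
    {h \<in> lin_maps A M N. \<forall>i j. h ` homog M i j \<subseteq> homog N (i + a) (j + b)}"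

text \<open>The graded Hom consists of the finite sums of bihomogeneous homomorphisms. Scalars act
  through the argument, so it is a module over every ring acting on \<open>M\<close> compatibly
  with \<open>A\<close>.\<close>

definition graded_Hom ::
    "('a, 'c) ring_scheme \<Rightarrow> ('a, 'm) bigraded \<Rightarrow> ('a, 'n) bigraded \<Rightarrow> ('a, 'm \<Rightarrow> 'n) bigraded" where
  "graded_Hom A M N =
    \<lparr>carrier = {h. \<exists>D g. finite D \<and> (\<forall>(a, b) \<in> D. g (a, b) \<in> bihom_maps A M N a b) \<and>
                    h = (\<lambda>u \<in> carrier M. \<Oplus>\<^bsub>N\<^esub>e\<in>D. g e u)},
     mult = undefined, one = undefined,
     zero = (\<lambda>u \<in> carrier M. \<zero>\<^bsub>N\<^esub>),
     add = (\<lambda>h h'. \<lambda>u \<in> carrier M. h u \<oplus>\<^bsub>N\<^esub> h' u),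
     smult = (\<lambda>c h. \<lambda>u \<in> carrier M. h (c \<odot>\<^bsub>M\<^esub> u)),
     homog = bihom_maps A M N\<rparr>"

end

theory Submission
  imports Defs "HOL-Library.Product_Plus"
begin

text \<open>
The proof compares the regular sequence \<open>f\<close> with the regular sequence
\<open>x\<^sub>0\<^sup>N, \<dots>, x\<^sub>d\<^sub>-\<^sub>1\<^sup>N\<close> of powers of the variables. For two regular sequences \<open>f\<close> and \<open>g\<close> of
length \<open>d\<close> in any commutative ring, both \<open>((f) : (g)) / (f)\<close> and \<open>((g) : (f)) / (g)\<close> are the \<open>d\<close>-th
homology of the Koszul complex of the concatenated sequence: a \<open>d\<close>-cycle assigns a ring element to
every \<open>d\<close>-element subset of the \<open>2 d\<close> indices, its value at the indices of \<open>g\<close> lies in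
\<open>(f) : (g)\<close>, and its value at the indices of \<open>f\<close> lies in \<open>(g) : (f)\<close>. Removing the elements of a
regular sequence one at a time (\<open>koszul_lift_cycle\<close>, \<open>koszul_lift_boundary\<close>) shows that either value
can be prescribed and that one of them vanishes modulo its ideal exactly if the other does
(\<open>koszul_linked_exists\<close>, \<open>koszul_linked_vanish\<close>).

For \<open>g\<close> the sequence of the \<open>x\<^sub>j\<^sup>N\<close>, the first quotient consists of the elements of \<open>S\<close> killed by
all \<open>x\<^sub>j\<^sup>N\<close>. The second one is a module of functionals: an element \<open>t\<close> of \<open>B\<close> acts on \<open>B\<close> by sending
\<open>b\<close> to the coefficient, in \<open>T\<close>, of \<open>(x\<^sub>0 \<cdots> x\<^sub>d\<^sub>-\<^sub>1)\<^sup>N\<^sup>-\<^sup>1\<close> in \<open>t b\<close>. This identifies \<open>B / (g)\<close>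
with the \<open>T\<close>-linear functionals on \<open>B\<close> that vanish on \<open>(g)\<close> (\<open>top_coeff_nondegenerate\<close>,
\<open>functional_eq_top_coeff\<close>), and \<open>(g) : (f)\<close> then corresponds to those that vanish on \<open>(f)\<close> as well,
which are functionals on \<open>S\<close>.

Degrees supply the shift and the choice of \<open>N\<close>. The Koszul complex is bigraded, so that an element \<open>s\<close>
of bidegree \<open>(i, j)\<close> is linked to \<open>t\<close> of bidegree \<open>(i + d N - \<Sum>\<alpha>, j - \<Sum>\<beta>)\<close>
(\<open>dual_pair_component\<close>); extracting the coefficient subtracts \<open>d (N - 1)\<close> from the \<open>x\<close>-degree and
leaves \<open>(i - \<delta>, j - \<tau>)\<close>. If \<open>i > \<delta>\<close>, then \<open>t\<close> has \<open>x\<close>-degree above \<open>d (N - 1)\<close> and lies in \<open>(g)\<close>,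
so \<open>s\<close> lies in \<open>(f)\<close>. Hence the torsion of \<open>S\<close> lives in \<open>x\<close>-degrees between \<open>0\<close> and \<open>\<delta>\<close>, and one
exponent \<open>N > \<delta>\<close> serves for all of \<open>H\<^sup>0\<close> (\<open>x_torsion_bounded_exponent\<close>) and, by the same
argument read backwards, for all bihomogeneous functionals on \<open>S\<close> (\<open>functional_dual_pair_bounded\<close>).
\<close>

section \<open>Ideals of a subring\<close>

text \<open>The rings of the theorem are subrings of one type of polynomials, so rings are treated as
subsets \<open>P\<close> of a type and ideals as subsets of \<open>P\<close>.\<close>

locale comm_subring =
  fixes P :: "'a::comm_ring_1 set"
  assumes zero_mem: "0 \<in> P" and one_mem: "1 \<in> P"
    and add_mem: "\<And>p q. p \<in> P \<Longrightarrow> q \<in> P \<Longrightarrow> p + q \<in> P"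
    and uminus_mem: "\<And>p. p \<in> P \<Longrightarrow> - p \<in> P"
    and mult_mem: "\<And>p q. p \<in> P \<Longrightarrow> q \<in> P \<Longrightarrow> p * q \<in> P"
begin

lemma diff_mem: "p \<in> P \<Longrightarrow> q \<in> P \<Longrightarrow> p - q \<in> P"
  using add_mem[of p "- q"] uminus_mem[of q] by simp

lemma sum_mem: "(\<And>i. i \<in> I \<Longrightarrow> g i \<in> P) \<Longrightarrow> sum g I \<in> P"
  by (induction I rule: infinite_finite_induct) (auto intro: zero_mem add_mem)

lemma additive_sum:
  fixes h :: "'a \<Rightarrow> 'c::ab_group_add"
  assumes h: "\<And>b c. b \<in> P \<Longrightarrow> c \<in> P \<Longrightarrow> h (b + c) = h b + h c"
    and g: "\<And>i. i \<in> A \<Longrightarrow> g i \<in> P"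
  shows "h (sum g A) = (\<Sum>i\<in>A. h (g i))"
proof -
  have h0: "h 0 = 0" using h[OF zero_mem zero_mem] by simp
  show ?thesis
    using g
  proof (induction A rule: infinite_finite_induct)
    case (insert x A)
    then have "h (g x + sum g A) = h (g x) + h (sum g A)" by (intro h sum_mem) auto
    then show ?case using insert by simp
  qed (simp_all add: h0)
qed

definition ideal_in :: "'a set \<Rightarrow> bool" where
  "ideal_in J \<longleftrightarrow> J \<subseteq> P \<and> 0 \<in> J \<and> (\<forall>p\<in>J. \<forall>q\<in>J. p + q \<in> J) \<and> (\<forall>c\<in>P. \<forall>p\<in>J. c * p \<in> J)"

lemma ideal_inD:
  assumes "ideal_in J"
  shows ideal_in_subset: "J \<subseteq> P" and ideal_in_zero: "0 \<in> J"
    and ideal_in_add: "p \<in> J \<Longrightarrow> q \<in> J \<Longrightarrow> p + q \<in> J"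
    and ideal_in_mult: "c \<in> P \<Longrightarrow> p \<in> J \<Longrightarrow> c * p \<in> J"
    and ideal_in_uminus: "p \<in> J \<Longrightarrow> - p \<in> J"
    and ideal_in_diff: "p \<in> J \<Longrightarrow> q \<in> J \<Longrightarrow> p - q \<in> J"
proof -
  show "J \<subseteq> P" "0 \<in> J" "p \<in> J \<Longrightarrow> q \<in> J \<Longrightarrow> p + q \<in> J" "c \<in> P \<Longrightarrow> p \<in> J \<Longrightarrow> c * p \<in> J"
    using assms by (auto simp: ideal_in_def)
  have neg: "- q \<in> J" if "q \<in> J" for q
    using assms that uminus_mem[OF one_mem] unfolding ideal_in_def
    by (metis mult_minus1)
  then show "p \<in> J \<Longrightarrow> - p \<in> J" .
  show "p \<in> J \<Longrightarrow> q \<in> J \<Longrightarrow> p - q \<in> J"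
    using assms neg[of q] unfolding ideal_in_def by (metis diff_conv_add_uminus)
qed

lemma ideal_in_sum:
  "ideal_in J \<Longrightarrow> (\<And>i. i \<in> I \<Longrightarrow> g i \<in> J) \<Longrightarrow> sum g I \<in> J"
  by (induction I rule: infinite_finite_induct) (auto intro: ideal_in_zero ideal_in_add)

definition span_ideal :: "(nat \<Rightarrow> 'a) \<Rightarrow> nat set \<Rightarrow> 'a set" where
  "span_ideal a I = {\<Sum>i\<in>I. c i * a i | c. \<forall>i. c i \<in> P}"

lemma span_idealI: "(\<And>i. c i \<in> P) \<Longrightarrow> (\<Sum>i\<in>I. c i * a i) \<in> span_ideal a I"
  by (auto simp: span_ideal_def)

lemma span_idealE:
  assumes "p \<in> span_ideal a I"
  obtains c where "\<And>i. c i \<in> P" "p = (\<Sum>i\<in>I. c i * a i)"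
  using assms by (auto simp: span_ideal_def)

lemma span_ideal_empty [simp]: "span_ideal a {} = {0}"
  using zero_mem by (auto simp: span_ideal_def)

lemma ideal_in_span_ideal:
  assumes "\<And>i. i \<in> I \<Longrightarrow> a i \<in> P"
  shows "ideal_in (span_ideal a I)"
  unfolding ideal_in_def
proof (intro conjI ballI)
  show "span_ideal a I \<subseteq> P"
    using assms by (auto simp: span_ideal_def intro!: sum_mem mult_mem)
  show "0 \<in> span_ideal a I"
    using span_idealI[of "\<lambda>_. 0" a I] zero_mem by simp
next
  fix p q assume "p \<in> span_ideal a I" "q \<in> span_ideal a I"
  then obtain c c' where "\<And>i. c i \<in> P" "p = (\<Sum>i\<in>I. c i * a i)"
    "\<And>i. c' i \<in> P" "q = (\<Sum>i\<in>I. c' i * a i)"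
    by (metis span_idealE)
  then show "p + q \<in> span_ideal a I"
    using span_idealI[of "\<lambda>i. c i + c' i" a I] add_mem
    by (simp add: sum.distrib distrib_right)
next
  fix b p assume "b \<in> P" "p \<in> span_ideal a I"
  then obtain c where "\<And>i. c i \<in> P" "p = (\<Sum>i\<in>I. c i * a i)"
    by (metis span_idealE)
  then show "b * p \<in> span_ideal a I"
    using span_idealI[of "\<lambda>i. b * c i" a I] mult_mem \<open>b \<in> P\<close>
    by (simp add: sum_distrib_left mult.assoc)
qed

lemma span_ideal_generator:
  assumes "finite I" "i \<in> I"
  shows "a i \<in> span_ideal a I"
proof -
  have "(\<Sum>j\<in>I. (if j = i then 1 else 0) * a j) = a i"
    using assms by (simp add: if_distrib[of "\<lambda>c. c * _"] sum.delta cong: if_cong)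
  then show ?thesis
    using span_idealI[of "\<lambda>j. if j = i then 1 else 0" a I] zero_mem one_mem by auto
qed

lemma span_ideal_insertE:
  assumes "finite I" "i \<notin> I" "p \<in> span_ideal a (insert i I)"
  obtains c where "c \<in> P" "p - a i * c \<in> span_ideal a I"
proof -
  obtain c where c: "\<And>j. c j \<in> P" "p = (\<Sum>j\<in>insert i I. c j * a j)"
    using assms by (metis span_idealE)
  have "p - a i * c i = (\<Sum>j\<in>I. c j * a j)"
    using assms c(2) by (simp add: algebra_simps)
  then show thesis
    using that[of "c i"] c(1) span_idealI[of c a I] by simp
qed

end

section \<open>Koszul complexes and regular sequences\<close>

text \<open>A chain over the index set \<open>V\<close> is a function on subsets of \<open>V\<close>, whose value at \<open>I\<close> is the
coefficient of the basis element \<open>e\<^sub>I\<close>; its homological degree is the cardinality of \<open>I\<close>.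
Restricting a chain to the subsets of a smaller index set is then plain restriction of functions.\<close>

definition koszul_sign :: "nat \<Rightarrow> nat set \<Rightarrow> 'a::comm_ring_1" where
  "koszul_sign i I = (- 1) ^ card {j \<in> I. j < i}"

definition koszul_bd :: "(nat \<Rightarrow> 'a::comm_ring_1) \<Rightarrow> nat set \<Rightarrow> (nat set \<Rightarrow> 'a) \<Rightarrow> nat set \<Rightarrow> 'a" where
  "koszul_bd a V z I = (\<Sum>i\<in>V - I. koszul_sign i I * a i * z (insert i I))"

lemma koszul_sign_square: "koszul_sign i I * koszul_sign i I = (1::'a::comm_ring_1)"
  by (simp add: koszul_sign_def flip: power_add mult_2 power_mult)

lemma koszul_sign_swap_aux:
  assumes "i < j" "i \<notin> I" "finite I"
  shows "koszul_sign i I * koszul_sign j (insert i I) =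
    - (koszul_sign j I * koszul_sign i (insert j I) :: 'a::comm_ring_1)"
proof -
  have "{k \<in> insert i I. k < j} = insert i {k \<in> I. k < j}" "{k \<in> insert j I. k < i} = {k \<in> I. k < i}"
    using assms by auto
  then show ?thesis
    using assms by (simp add: koszul_sign_def)
qed

lemma koszul_sign_swap:
  assumes "i \<noteq> j" "i \<notin> I" "j \<notin> I" "finite I"
  shows "koszul_sign i I * koszul_sign j (insert i I) =
    - (koszul_sign j I * koszul_sign i (insert j I) :: 'a::comm_ring_1)"
proof (cases "i < j")
  case True
  then show ?thesis using assms koszul_sign_swap_aux[of i j I] by simp
next
  case False
  then show ?thesis using assms koszul_sign_swap_aux[of j i I, where ?'a = 'a] by simp
qed

text \<open>Adding \<open>x\<close> to \<open>V\<close> adds a row and a column that cancel each other; this works in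
characteristic 2, where antisymmetry of the whole sum would say nothing.\<close>

lemma sum_antisymmetric:
  fixes g :: "'i::linorder \<Rightarrow> 'i \<Rightarrow> 'a::ab_group_add"
  assumes "finite V" and anti: "\<And>i j. i \<in> V \<Longrightarrow> j \<in> V \<Longrightarrow> i \<noteq> j \<Longrightarrow> g i j = - g j i"
  shows "(\<Sum>i\<in>V. \<Sum>j\<in>V - {i}. g i j) = 0"
  using assms
proof (induction V rule: finite_induct)
  case (insert x V)
  have *: "insert x V - {x} = V" using insert.hyps by auto
  have "(\<Sum>j\<in>insert x V - {i}. g i j) = g i x + (\<Sum>j\<in>V - {i}. g i j)" if "i \<in> V" for i
  proof -
    have "insert x V - {i} = insert x (V - {i})" using insert.hyps that by auto
    then show ?thesis using insert.hyps by simp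
  qed
  moreover have "(\<Sum>i\<in>V. \<Sum>j\<in>V - {i}. g i j) = 0"
    by (rule insert.IH) (rule insert.prems, auto)
  ultimately have "(\<Sum>i\<in>V. \<Sum>j\<in>insert x V - {i}. g i j) = (\<Sum>i\<in>V. g i x)"
    by (simp add: sum.distrib)
  moreover have "(\<Sum>j\<in>V. g x j) = (\<Sum>i\<in>V. - g i x)"
  proof (rule sum.cong)
    fix j assume "j \<in> V"
    then show "g x j = - g j x" using insert.hyps by (intro insert.prems) auto
  qed simp
  ultimately show ?case
    using insert.hyps * by (simp add: sum_negf)
qed simp

text \<open>\<open>I \<union> {i, j}\<close> is reached from \<open>I\<close> in two orders, with opposite signs.\<close>

lemma koszul_bd_bd:
  fixes a :: "nat \<Rightarrow> 'a::comm_ring_1"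
  assumes "finite V" "I \<subseteq> V"
  shows "koszul_bd a V (koszul_bd a V z) I = 0"
proof -
  let ?g = "\<lambda>i j. koszul_sign i I * koszul_sign j (insert i I) * a i * a j * z (insert j (insert i I))"
  have "koszul_bd a V (koszul_bd a V z) I = (\<Sum>i\<in>V - I. \<Sum>j\<in>V - I - {i}. ?g i j)"
    unfolding koszul_bd_def sum_distrib_left
    by (intro sum.cong) (auto simp: algebra_simps)
  also have "\<dots> = 0"
  proof (rule sum_antisymmetric)
    fix i j assume ij: "i \<in> V - I" "j \<in> V - I" "i \<noteq> j"
    have "?g i j = (koszul_sign i I * koszul_sign j (insert i I)) * (a i * a j * z (insert j (insert i I)))"
      by (simp add: algebra_simps)
    also have "\<dots> = - (koszul_sign j I * koszul_sign i (insert j I)) * (a i * a j * z (insert j (insert i I)))"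
      using ij assms by (subst koszul_sign_swap) (auto dest: finite_subset)
    also have "\<dots> = - ?g j i"
      by (simp add: algebra_simps insert_commute)
    finally show "?g i j = - ?g j i" .
  qed (use assms in auto)
  finally show ?thesis .
qed

lemma koszul_bd_cong:
  assumes "\<And>i. i \<in> V - I \<Longrightarrow> z (insert i I) = w (insert i I)"
  shows "koszul_bd a V z I = koszul_bd a V w I"
  unfolding koszul_bd_def using assms by (intro sum.cong) auto

lemma koszul_bd_insert:
  assumes "finite V" "i \<notin> V" "i \<notin> I"
  shows "koszul_bd a (insert i V) z I = koszul_sign i I * a i * z (insert i I) + koszul_bd a V z I"
proof -
  have "insert i V - I = insert i (V - I)" using assms by auto
  then show ?thesis using assms by (simp add: koszul_bd_def)
qed

lemma koszul_bd_diff: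
  "koszul_bd a V (\<lambda>I. z I - w I) I = koszul_bd a V z I - koszul_bd a V w I"
  by (simp add: koszul_bd_def algebra_simps sum_subtractf)

lemma koszul_bd_add:
  "koszul_bd a V (\<lambda>I. z I + w I) I = koszul_bd a V z I + koszul_bd a V w I"
  by (simp add: koszul_bd_def algebra_simps sum.distrib)

lemma koszul_bd_mult:
  "koszul_bd a V (\<lambda>I. c * z I) I = c * koszul_bd a V z I"
  by (simp add: koszul_bd_def algebra_simps sum_distrib_left)

context comm_subring
begin

lemma koszul_sign_mem: "koszul_sign i I \<in> P"
proof -
  have "(- 1) ^ k \<in> P" for k
    by (induction k) (auto intro: one_mem uminus_mem mult_mem)
  then show ?thesis by (simp add: koszul_sign_def)
qed

lemma koszul_bd_mem:
  assumes "\<And>i. i \<in> V \<Longrightarrow> a i \<in> P" "\<And>I. z I \<in> P"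
  shows "koszul_bd a V z I \<in> P"
  unfolding koszul_bd_def using assms by (auto intro!: sum_mem mult_mem koszul_sign_mem)

lemma koszul_bd_in_ideal:
  assumes "ideal_in J" "\<And>i. i \<in> V \<Longrightarrow> a i \<in> P" "\<And>i. i \<in> V - I \<Longrightarrow> z (insert i I) \<in> J"
  shows "koszul_bd a V z I \<in> J"
  unfolding koszul_bd_def using assms
  by (auto intro!: ideal_in_sum[OF assms(1)] ideal_in_mult[OF assms(1)] mult_mem koszul_sign_mem)

definition nonzerodivisor_mod :: "'a \<Rightarrow> 'a set \<Rightarrow> bool" where
  "nonzerodivisor_mod c J \<longleftrightarrow> (\<forall>b\<in>P. c * b \<in> J \<longrightarrow> b \<in> J)"

lemma nonzerodivisor_mod_sign:
  assumes "ideal_in J" "nonzerodivisor_mod c J" "c \<in> P" "b \<in> P" "koszul_sign i I * c * b \<in> J"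
  shows "b \<in> J"
proof -
  have "koszul_sign i I * (koszul_sign i I * c * b) \<in> J"
    using assms koszul_sign_mem ideal_in_mult by blast
  then have "c * b \<in> J"
    by (simp add: mult.assoc[symmetric] koszul_sign_square)
  then show ?thesis using assms by (auto simp: nonzerodivisor_mod_def)
qed

text \<open>Restriction of chains from subsets of \<open>insert i V\<close> to subsets of \<open>V\<close> induces an isomorphism from the
Koszul homology of \<open>P / J\<close> over \<open>insert i V\<close> to that of \<open>P / (J + a\<^sub>i P)\<close> over \<open>V\<close> if \<open>a\<^sub>i\<close> is a
nonzerodivisor modulo \<open>J\<close>. This lemma is its surjectivity: the cycle condition at \<open>I \<subseteq> V\<close> dictates
the values at \<open>insert i I\<close>, and the remaining cycle conditions follow from \<open>\<partial>\<^sup>2 = 0\<close> by cancelling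
\<open>a\<^sub>i\<close>.\<close>

lemma koszul_lift_cycle_step:
  assumes J: "ideal_in J" and V: "finite V" "i \<notin> V" and a: "\<And>j. j \<in> insert i V \<Longrightarrow> a j \<in> P"
    and reg: "nonzerodivisor_mod (a i) J"
    and u: "\<And>I. u I \<in> P"
    and cyc: "\<And>I. I \<subseteq> V \<Longrightarrow> Suc (card I) = p \<Longrightarrow> \<exists>c\<in>P. koszul_bd a V u I - a i * c \<in> J"
  shows "\<exists>z. (\<forall>I. z I \<in> P) \<and> (\<forall>I\<subseteq>V. z I = u I) \<and>
    (\<forall>I\<subseteq>insert i V. Suc (card I) = p \<longrightarrow> koszul_bd a (insert i V) z I \<in> J)"
proof -
  define good where "good I \<longleftrightarrow> I \<subseteq> V \<and> Suc (card I) = p" for I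
  have "\<forall>I. \<exists>c. c \<in> P \<and> (good I \<longrightarrow> koszul_bd a V u I - a i * c \<in> J)"
    using cyc zero_mem unfolding good_def by blast
  then obtain c where c: "\<And>I. c I \<in> P" "\<And>I. good I \<Longrightarrow> koszul_bd a V u I - a i * c I \<in> J"
    by metis
  define z where "z I = (if i \<in> I then - (koszul_sign i (I - {i}) * c (I - {i})) else u I)" for I
  have zP: "z I \<in> P" for I
    using c u by (auto simp: z_def intro!: uminus_mem mult_mem koszul_sign_mem)
  have zu: "z I = u I" if "I \<subseteq> V" for I
    using that V by (auto simp: z_def)
  have base: "koszul_bd a (insert i V) z I \<in> J" if I: "I \<subseteq> V" "Suc (card I) = p" for I
  proof -
    have iI: "i \<notin> I" using I V by auto
    have "koszul_bd a V z I = koszul_bd a V u I"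
      using I by (intro koszul_bd_cong) (auto intro: zu)
    moreover have "koszul_sign i I * a i * z (insert i I) = - (koszul_sign i I * koszul_sign i I) * a i * c I"
      using iI by (simp add: z_def algebra_simps)
    ultimately have "koszul_bd a (insert i V) z I = koszul_bd a V u I - a i * c I"
      using koszul_bd_insert[OF V iI, of a z] by (simp add: koszul_sign_square)
    then show ?thesis using c(2)[of I] I by (simp add: good_def)
  qed
  have "koszul_bd a (insert i V) z I \<in> J" if I: "I \<subseteq> insert i V" "Suc (card I) = p" for I
  proof (cases "i \<in> I")
    case False
    then show ?thesis using base I by blast
  next
    case True
    define I' where "I' = I - {i}"
    have I': "I' \<subseteq> V" "i \<notin> I'" "I = insert i I'"
      using True I by (auto simp: I'_def)
    have fI': "finite I'" using I' V finite_subset by blast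
    let ?y = "koszul_bd a (insert i V) z"
    \<comment> \<open>Applying \<open>\<partial>\<^sup>2 = 0\<close> at \<open>I'\<close> expresses \<open>a\<^sub>i\<close> times the wanted value through values in \<open>J\<close>.\<close>
    have "0 = koszul_sign i I' * a i * ?y I + koszul_bd a V ?y I'"
      using koszul_bd_bd[of "insert i V" I' a z] V I' koszul_bd_insert[of V i I' a ?y] by auto
    moreover have "koszul_bd a V ?y I' \<in> J"
    proof (rule koszul_bd_in_ideal[OF J])
      fix j assume j: "j \<in> V - I'"
      then have "card (insert j I') = card I" using I' fI' by simp
      then show "?y (insert j I') \<in> J"
        using j I I' by (intro base) auto
    qed (use a in auto)
    ultimately have "koszul_sign i I' * a i * ?y I \<in> J"
      using ideal_in_uminus[OF J] by (metis add_eq_0_iff2)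
    then show ?thesis
      by (rule nonzerodivisor_mod_sign[OF J reg, rotated 2])
        (use a zP in \<open>auto intro: koszul_bd_mem\<close>)
  qed
  then show ?thesis using zP zu by blast
qed

text \<open>Injectivity of the same restriction: \<open>w\<close>, extended by the multipliers \<open>c\<close> of \<open>a\<^sub>i\<close>, has a boundary
that agrees with \<open>z\<close> modulo \<open>J\<close> on subsets of \<open>V\<close>. The difference is a cycle, so that \<open>a\<^sub>i\<close> times its
value at a set containing \<open>i\<close> is a combination of its values on subsets of \<open>V\<close>.\<close>

lemma koszul_lift_boundary_step:
  assumes J: "ideal_in J" and V: "finite V" "i \<notin> V" and a: "\<And>j. j \<in> insert i V \<Longrightarrow> a j \<in> P"
    and reg: "nonzerodivisor_mod (a i) J"
    and z: "\<And>I. z I \<in> P" and w: "\<And>I. w I \<in> P"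
    and cyc: "\<And>I. I \<subseteq> insert i V \<Longrightarrow> Suc (card I) = p \<Longrightarrow> koszul_bd a (insert i V) z I \<in> J"
    and bd: "\<And>I. I \<subseteq> V \<Longrightarrow> card I = p \<Longrightarrow> \<exists>c\<in>P. z I - koszul_bd a V w I - a i * c \<in> J"
  shows "\<exists>w'. (\<forall>I. w' I \<in> P) \<and>
    (\<forall>I\<subseteq>insert i V. card I = p \<longrightarrow> z I - koszul_bd a (insert i V) w' I \<in> J)"
proof -
  define good where "good I \<longleftrightarrow> I \<subseteq> V \<and> card I = p" for I
  have "\<forall>I. \<exists>c. c \<in> P \<and> (good I \<longrightarrow> z I - koszul_bd a V w I - a i * c \<in> J)"
    using bd zero_mem unfolding good_def by blast
  then obtain c where c: "\<And>I. c I \<in> P" "\<And>I. good I \<Longrightarrow> z I - koszul_bd a V w I - a i * c I \<in> J"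
    by metis
  define w' where "w' I = (if i \<in> I then koszul_sign i (I - {i}) * c (I - {i}) else w I)" for I
  have w'P: "w' I \<in> P" for I
    using c w by (auto simp: w'_def intro!: mult_mem koszul_sign_mem)
  define y where "y I = z I - koszul_bd a (insert i V) w' I" for I
  have yP: "y I \<in> P" for I
    unfolding y_def using z w'P a by (intro diff_mem koszul_bd_mem) auto
  have base: "y I \<in> J" if I: "I \<subseteq> V" "card I = p" for I
  proof -
    have iI: "i \<notin> I" using I V by auto
    have "koszul_bd a V w' I = koszul_bd a V w I"
      using I V by (intro koszul_bd_cong) (auto simp: w'_def)
    moreover have "koszul_sign i I * a i * w' (insert i I) = (koszul_sign i I * koszul_sign i I) * a i * c I"
      using iI by (simp add: w'_def algebra_simps)
    ultimately have "y I = z I - koszul_bd a V w I - a i * c I"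
      using koszul_bd_insert[OF V iI, of a w'] by (simp add: koszul_sign_square y_def)
    then show ?thesis using c(2)[of I] I by (simp add: good_def)
  qed
  have ycyc: "koszul_bd a (insert i V) y I \<in> J" if "I \<subseteq> insert i V" "Suc (card I) = p" for I
    unfolding y_def using cyc[OF that] koszul_bd_bd[of "insert i V" I a w'] V that
    by (simp add: koszul_bd_diff)
  have "y I \<in> J" if I: "I \<subseteq> insert i V" "card I = p" for I
  proof (cases "i \<in> I")
    case False
    then show ?thesis using base I by blast
  next
    case True
    define I' where "I' = I - {i}"
    have I': "I' \<subseteq> V" "i \<notin> I'" "I = insert i I'"
      using True I by (auto simp: I'_def)
    have fI': "finite I'" using I' V finite_subset by blast
    have "koszul_bd a V y I' \<in> J"
    proof (rule koszul_bd_in_ideal[OF J])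
      fix j assume j: "j \<in> V - I'"
      then have "card (insert j I') = card I" using I' fI' by simp
      then show "y (insert j I') \<in> J"
        using j I I' by (intro base) auto
    qed (use a in auto)
    moreover have "koszul_sign i I' * a i * y I + koszul_bd a V y I' \<in> J"
      using ycyc[of I'] I I' fI' koszul_bd_insert[OF V, of I' a y] by auto
    ultimately have "koszul_sign i I' * a i * y I \<in> J"
      using ideal_in_diff[OF J] by (metis add_diff_cancel_right')
    then show ?thesis
      by (rule nonzerodivisor_mod_sign[OF J reg, rotated 2]) (use a yP in auto)
  qed
  then show ?thesis using w'P unfolding y_def by blast
qed

text \<open>The elements of the regular sequence are moved from the ideal into the index set, the last one first,
because \<open>a\<^bsub>m+k\<^esub>\<close> is a nonzerodivisor modulo the elements before it.\<close>

lemma koszul_lift_cycle: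
  assumes "finite W" "W \<inter> {m..<m+k} = {}" "\<And>j. j \<in> W \<union> {m..<m+k} \<Longrightarrow> a j \<in> P"
    and "\<And>j. j < k \<Longrightarrow> nonzerodivisor_mod (a (m + j)) (span_ideal a {m..<m+j})"
    and "\<And>I. u I \<in> P"
    and "\<And>I. I \<subseteq> W \<Longrightarrow> Suc (card I) = p \<Longrightarrow> koszul_bd a W u I \<in> span_ideal a {m..<m+k}"
  shows "\<exists>z. (\<forall>I. z I \<in> P) \<and> (\<forall>I\<subseteq>W. z I = u I) \<and>
    (\<forall>I\<subseteq>W \<union> {m..<m+k}. Suc (card I) = p \<longrightarrow> koszul_bd a (W \<union> {m..<m+k}) z I = 0)"
  using assms
proof (induction k arbitrary: W u)
  case 0
  then show ?case by (intro exI[of _ u]) auto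
next
  case (Suc k)
  have ins: "{m..<m + Suc k} = insert (m + k) {m..<m+k}" by auto
  have "\<exists>z. (\<forall>I. z I \<in> P) \<and> (\<forall>I\<subseteq>W. z I = u I) \<and>
    (\<forall>I\<subseteq>insert (m + k) W. Suc (card I) = p \<longrightarrow> koszul_bd a (insert (m + k) W) z I \<in> span_ideal a {m..<m+k})"
  proof (rule koszul_lift_cycle_step)
    show "ideal_in (span_ideal a {m..<m+k})"
      using Suc.prems(3) by (intro ideal_in_span_ideal) auto
    fix I assume "I \<subseteq> W" "Suc (card I) = p"
    then have "koszul_bd a W u I \<in> span_ideal a (insert (m + k) {m..<m+k})"
      using Suc.prems(6) ins by simp
    then show "\<exists>c\<in>P. koszul_bd a W u I - a (m + k) * c \<in> span_ideal a {m..<m+k}"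
      using span_ideal_insertE[of "{m..<m+k}" "m + k" _ a] by (metis atLeastLessThan_iff finite_atLeastLessThan less_irrefl)
  qed (use Suc.prems in auto)
  then obtain z where z: "\<And>I. z I \<in> P" "\<And>I. I \<subseteq> W \<Longrightarrow> z I = u I"
    "\<And>I. I \<subseteq> insert (m + k) W \<Longrightarrow> Suc (card I) = p \<Longrightarrow> koszul_bd a (insert (m + k) W) z I \<in> span_ideal a {m..<m+k}"
    by blast
  have "\<exists>z'. (\<forall>I. z' I \<in> P) \<and> (\<forall>I\<subseteq>insert (m + k) W. z' I = z I) \<and>
    (\<forall>I\<subseteq>insert (m + k) W \<union> {m..<m+k}. Suc (card I) = p \<longrightarrow> koszul_bd a (insert (m + k) W \<union> {m..<m+k}) z' I = 0)"
    using Suc.prems z by (intro Suc.IH) auto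
  moreover have "insert (m + k) W \<union> {m..<m+k} = W \<union> {m..<m + Suc k}" using ins by auto
  ultimately show ?case using z(2) by (metis subset_insertI2)
qed

lemma koszul_lift_boundary:
  assumes "finite W" "W \<inter> {m..<m+k} = {}" "\<And>j. j \<in> W \<union> {m..<m+k} \<Longrightarrow> a j \<in> P"
    and "\<And>j. j < k \<Longrightarrow> nonzerodivisor_mod (a (m + j)) (span_ideal a {m..<m+j})"
    and "\<And>I. z I \<in> P" "\<And>I. w I \<in> P"
    and "\<And>I. I \<subseteq> W \<union> {m..<m+k} \<Longrightarrow> Suc (card I) = p \<Longrightarrow> koszul_bd a (W \<union> {m..<m+k}) z I = 0"
    and "\<And>I. I \<subseteq> W \<Longrightarrow> card I = p \<Longrightarrow> z I - koszul_bd a W w I \<in> span_ideal a {m..<m+k}"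
  shows "\<exists>w'. (\<forall>I. w' I \<in> P) \<and>
    (\<forall>I\<subseteq>W \<union> {m..<m+k}. card I = p \<longrightarrow> z I = koszul_bd a (W \<union> {m..<m+k}) w' I)"
  using assms
proof (induction k arbitrary: W w)
  case 0
  then show ?case by (intro exI[of _ w]) auto
next
  case (Suc k)
  have ins: "{m..<m + Suc k} = insert (m + k) {m..<m+k}" by auto
  have eq: "insert (m + k) W \<union> {m..<m+k} = W \<union> {m..<m + Suc k}" using ins by auto
  let ?J = "span_ideal a {m..<m+k}"
  have J: "ideal_in ?J"
    using Suc.prems(3) by (intro ideal_in_span_ideal) auto
  have "\<exists>w'. (\<forall>I. w' I \<in> P) \<and>
    (\<forall>I\<subseteq>insert (m + k) W. card I = p \<longrightarrow> z I - koszul_bd a (insert (m + k) W) w' I \<in> ?J)"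
  proof (rule koszul_lift_boundary_step[OF J])
    fix I assume I: "I \<subseteq> W" "card I = p"
    then have "z I - koszul_bd a W w I \<in> span_ideal a (insert (m + k) {m..<m+k})"
      using Suc.prems(8) ins by simp
    then show "\<exists>c\<in>P. z I - koszul_bd a W w I - a (m + k) * c \<in> ?J"
      using span_ideal_insertE[of "{m..<m+k}" "m + k" _ a] by (metis atLeastLessThan_iff finite_atLeastLessThan less_irrefl)
  next
    fix I assume I: "I \<subseteq> insert (m + k) W" "Suc (card I) = p"
    \<comment> \<open>The omitted terms of the boundary have coefficients \<open>a\<^sub>j\<close> with \<open>j\<close> in the range spanning the ideal.\<close>
    let ?T = "W \<union> {m..<m + Suc k}" and ?R = "{m..<m+k} - I"
    have split: "?T - I = (insert (m + k) W - I) \<union> ?R" "(insert (m + k) W - I) \<inter> ?R = {}"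
      using Suc.prems(2) I by auto
    let ?g = "\<lambda>i. koszul_sign i I * a i * z (insert i I)"
    have "0 = koszul_bd a ?T z I" using Suc.prems(7)[of I] I eq by auto
    also have "\<dots> = koszul_bd a (insert (m + k) W) z I + sum ?g ?R"
      unfolding koszul_bd_def split(1)
      using Suc.prems(1) split(2) by (intro sum.union_disjoint) auto
    finally have e: "koszul_bd a (insert (m + k) W) z I = - sum ?g ?R"
      by (simp add: eq_neg_iff_add_eq_0)
    have "?g i \<in> ?J" if "i \<in> ?R" for i
    proof -
      have "koszul_sign i I * z (insert i I) * a i \<in> ?J"
        using that Suc.prems(5) by (intro ideal_in_mult[OF J] mult_mem koszul_sign_mem span_ideal_generator) auto
      then show ?thesis by (simp add: ac_simps)
    qed
    then show "koszul_bd a (insert (m + k) W) z I \<in> ?J"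
      unfolding e by (intro ideal_in_uminus[OF J] ideal_in_sum[OF J])
  qed (use Suc.prems in auto)
  then obtain w' where w': "\<And>I. w' I \<in> P"
    "\<And>I. I \<subseteq> insert (m + k) W \<Longrightarrow> card I = p \<Longrightarrow> z I - koszul_bd a (insert (m + k) W) w' I \<in> ?J"
    by blast
  have "\<exists>w''. (\<forall>I. w'' I \<in> P) \<and>
    (\<forall>I\<subseteq>insert (m + k) W \<union> {m..<m+k}. card I = p \<longrightarrow> z I = koszul_bd a (insert (m + k) W \<union> {m..<m+k}) w'' I)"
    using Suc.prems w' eq by (intro Suc.IH[of "insert (m + k) W" w']) auto
  then show ?case by (simp only: eq)
qed

section \<open>Linkage of two regular sequences\<close>

text \<open>If \<open>A\<close> and \<open>B\<close> are disjoint, have \<open>p\<close> elements each and index regular sequences, this relation between \<open>s\<close> and \<open>t\<close> is the graph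
of the isomorphism from \<open>((a\<^sub>B) : (a\<^sub>A)) / (a\<^sub>B)\<close> to \<open>((a\<^sub>A) : (a\<^sub>B)) / (a\<^sub>A)\<close>, lifted to representatives. As a
relation it is visibly symmetric and linear.\<close>

definition koszul_linked :: "(nat \<Rightarrow> 'a) \<Rightarrow> nat set \<Rightarrow> nat set \<Rightarrow> nat \<Rightarrow> 'a \<Rightarrow> 'a \<Rightarrow> bool" where
  "koszul_linked a A B p s t \<longleftrightarrow> (\<exists>z. (\<forall>I. z I \<in> P) \<and>
     (\<forall>I\<subseteq>A \<union> B. Suc (card I) = p \<longrightarrow> koszul_bd a (A \<union> B) z I = 0) \<and> z A = s \<and> z B = t)"

lemma koszul_linked_sym: "koszul_linked a A B p s t \<Longrightarrow> koszul_linked a B A p t s"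
  unfolding koszul_linked_def Un_commute[of B A] by blast

lemma koszul_linked_mem: "koszul_linked a A B p s t \<Longrightarrow> s \<in> P \<and> t \<in> P"
  unfolding koszul_linked_def by blast

lemma koszul_linked_add:
  assumes "koszul_linked a A B p s t" "koszul_linked a A B p s' t'"
  shows "koszul_linked a A B p (s + s') (t + t')"
proof -
  obtain z z' where "\<forall>I. z I \<in> P" "\<forall>I\<subseteq>A \<union> B. Suc (card I) = p \<longrightarrow> koszul_bd a (A \<union> B) z I = 0"
    "z A = s" "z B = t" "\<forall>I. z' I \<in> P"
    "\<forall>I\<subseteq>A \<union> B. Suc (card I) = p \<longrightarrow> koszul_bd a (A \<union> B) z' I = 0" "z' A = s'" "z' B = t'"
    using assms unfolding koszul_linked_def by blast
  then show ?thesis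
    unfolding koszul_linked_def
    by (intro exI[of _ "\<lambda>I. z I + z' I"]) (auto simp: koszul_bd_add intro: add_mem)
qed

lemma koszul_linked_mult:
  assumes "koszul_linked a A B p s t" "c \<in> P"
  shows "koszul_linked a A B p (c * s) (c * t)"
proof -
  obtain z where "\<forall>I. z I \<in> P" "\<forall>I\<subseteq>A \<union> B. Suc (card I) = p \<longrightarrow> koszul_bd a (A \<union> B) z I = 0"
    "z A = s" "z B = t"
    using assms unfolding koszul_linked_def by blast
  then show ?thesis
    unfolding koszul_linked_def
    by (intro exI[of _ "\<lambda>I. c * z I"]) (auto simp: koszul_bd_mult intro: mult_mem assms)
qed

lemma koszul_linked_diff:
  assumes "koszul_linked a A B p s t" "koszul_linked a A B p s' t'"
  shows "koszul_linked a A B p (s - s') (t - t')"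
  using koszul_linked_add[OF assms(1) koszul_linked_mult[OF assms(2), of "- 1"]]
    uminus_mem[OF one_mem] by simp

text \<open>The cycle condition at \<open>A - {j}\<close> expresses \<open>a\<^sub>j s\<close> through the \<open>a\<^sub>i\<close> with \<open>i \<in> B\<close>.\<close>

lemma koszul_linked_colon:
  assumes "koszul_linked a A B p s t" "finite A" "finite B" "A \<inter> B = {}" "card A = p" "j \<in> A"
    and a: "\<And>i. i \<in> A \<union> B \<Longrightarrow> a i \<in> P"
  shows "a j * s \<in> span_ideal a B"
proof -
  obtain z where z: "\<And>I. z I \<in> P" "\<And>I. I \<subseteq> A \<union> B \<Longrightarrow> Suc (card I) = p \<Longrightarrow> koszul_bd a (A \<union> B) z I = 0"
    "z A = s" "z B = t"
    using assms(1) unfolding koszul_linked_def by blast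
  have J: "ideal_in (span_ideal a B)" using a by (intro ideal_in_span_ideal) auto
  let ?I = "A - {j}"
  have "Suc (card ?I) = p" using assms(2,5,6) by (simp only: card_Suc_Diff1)
  then have "koszul_bd a (A \<union> B) z ?I = 0" using z(2)[of ?I] assms(6) by (metis Diff_subset le_supI1)
  moreover have "A \<union> B = insert j (?I \<union> B)" using assms(6) by auto
  ultimately have "koszul_bd a (insert j (?I \<union> B)) z ?I = 0" by simp
  moreover have "insert j ?I = A" using assms(6) by auto
  ultimately have *: "koszul_sign j ?I * a j * s + koszul_bd a (?I \<union> B) z ?I = 0"
    using koszul_bd_insert[of "?I \<union> B" j ?I a z] assms(2-4,6) z(3) by (simp add: disjoint_iff)
  have "?I \<union> B - ?I = B" using assms(4) by auto
  then have "koszul_bd a (?I \<union> B) z ?I = (\<Sum>i\<in>B. koszul_sign i ?I * z (insert i ?I) * a i)"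
    by (simp add: koszul_bd_def ac_simps)
  then have "koszul_sign j ?I * a j * s = - (\<Sum>i\<in>B. koszul_sign i ?I * z (insert i ?I) * a i)"
    using * by (simp only: eq_neg_iff_add_eq_0)
  also have "\<dots> \<in> span_ideal a B"
    by (intro ideal_in_uminus[OF J] span_idealI mult_mem koszul_sign_mem z)
  finally have "koszul_sign j ?I * (koszul_sign j ?I * a j * s) \<in> span_ideal a B"
    by (rule ideal_in_mult[OF J koszul_sign_mem])
  then show ?thesis by (simp only: mult.assoc[symmetric] koszul_sign_square mult_1_left)
qed

definition regular_on :: "(nat \<Rightarrow> 'a) \<Rightarrow> nat \<Rightarrow> nat \<Rightarrow> bool" where
  "regular_on a m p \<longleftrightarrow> (\<forall>j<p. nonzerodivisor_mod (a (m + j)) (span_ideal a {m..<m+j}))"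

text \<open>The colon condition says that \<open>s e\<^sub>A\<close> is a cycle over \<open>A\<close> modulo the ideal of the second sequence, and
such a cycle lifts.\<close>

lemma koszul_linked_exists:
  assumes "finite A" "card A = p" "A \<inter> {m..<m+p} = {}" "s \<in> P"
    and a: "\<And>i. i \<in> A \<union> {m..<m+p} \<Longrightarrow> a i \<in> P"
    and reg: "regular_on a m p"
    and colon: "\<And>j. j \<in> A \<Longrightarrow> a j * s \<in> span_ideal a {m..<m+p}"
  shows "\<exists>t. koszul_linked a A {m..<m+p} p s t"
proof -
  have J: "ideal_in (span_ideal a {m..<m+p})" using a by (intro ideal_in_span_ideal) auto
  let ?u = "\<lambda>I. if I = A then s else 0"
  have "koszul_bd a A ?u I \<in> span_ideal a {m..<m+p}" for I
    unfolding koszul_bd_def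
  proof (rule ideal_in_sum[OF J])
    fix i assume "i \<in> A - I"
    then have "koszul_sign i I * (a i * s) \<in> span_ideal a {m..<m+p}"
      by (intro ideal_in_mult[OF J] koszul_sign_mem colon) auto
    then show "koszul_sign i I * a i * ?u (insert i I) \<in> span_ideal a {m..<m+p}"
      using ideal_in_zero[OF J] by (simp add: mult.assoc)
  qed
  then have "\<exists>z. (\<forall>I. z I \<in> P) \<and> (\<forall>I\<subseteq>A. z I = ?u I) \<and>
    (\<forall>I\<subseteq>A \<union> {m..<m+p}. Suc (card I) = p \<longrightarrow> koszul_bd a (A \<union> {m..<m+p}) z I = 0)"
    using assms zero_mem by (intro koszul_lift_cycle) (auto simp: regular_on_def)
  then obtain z where "\<forall>I. z I \<in> P" "\<forall>I\<subseteq>A. z I = ?u I"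
    "\<forall>I\<subseteq>A \<union> {m..<m+p}. Suc (card I) = p \<longrightarrow> koszul_bd a (A \<union> {m..<m+p}) z I = 0"
    by blast
  then show ?thesis
    unfolding koszul_linked_def by (intro exI[of _ "z {m..<m+p}"] exI[of _ z]) simp
qed

text \<open>If \<open>s\<close> lies in the ideal of the second sequence, the cycle restricts to zero over \<open>A\<close> modulo that ideal and
is therefore a boundary; a boundary evaluated at the second index set is a combination of the \<open>a\<^sub>i\<close> with
\<open>i \<in> A\<close>.\<close>

lemma koszul_linked_vanish:
  assumes "koszul_linked a A {m..<m+p} p s t"
    and "finite A" "card A = p" "A \<inter> {m..<m+p} = {}"
    and a: "\<And>i. i \<in> A \<union> {m..<m+p} \<Longrightarrow> a i \<in> P"
    and reg: "regular_on a m p"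
    and s: "s \<in> span_ideal a {m..<m+p}"
  shows "t \<in> span_ideal a A"
proof -
  let ?B = "{m..<m+p}"
  obtain z where z: "\<And>I. z I \<in> P" "\<And>I. I \<subseteq> A \<union> ?B \<Longrightarrow> Suc (card I) = p \<Longrightarrow> koszul_bd a (A \<union> ?B) z I = 0"
    "z A = s" "z ?B = t"
    using assms(1) unfolding koszul_linked_def by blast
  have "\<exists>w. (\<forall>I. w I \<in> P) \<and> (\<forall>I\<subseteq>A \<union> ?B. card I = p \<longrightarrow> z I = koszul_bd a (A \<union> ?B) w I)"
  proof (rule koszul_lift_boundary[where w = "\<lambda>_. 0"])
    fix I assume I: "I \<subseteq> A" "card I = p"
    then have "I = A" using assms(2,3) card_subset_eq by metis
    then show "z I - koszul_bd a A (\<lambda>_. 0) I \<in> span_ideal a ?B"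
      using s z by (simp add: koszul_bd_def)
  qed (use assms z zero_mem in \<open>auto simp: regular_on_def\<close>)
  then obtain w where w: "\<And>I. w I \<in> P" "\<And>I. I \<subseteq> A \<union> ?B \<Longrightarrow> card I = p \<Longrightarrow> z I = koszul_bd a (A \<union> ?B) w I"
    by blast
  have t: "t = koszul_bd a (A \<union> ?B) w ?B"
    using w(2)[of ?B] z(4) by simp
  have "A \<union> ?B - ?B = A" using assms(4) by auto
  then have "t = (\<Sum>i\<in>A. koszul_sign i ?B * w (insert i ?B) * a i)"
    unfolding t koszul_bd_def by (simp add: ac_simps)
  then show ?thesis by (simp add: span_idealI koszul_sign_mem mult_mem w(1))
qed

text \<open>\<open>K c\<close> stands for the projection to degree \<open>c\<close>. The differential is homogeneous if \<open>e\<^sub>I\<close> has degree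
\<open>\<Sum>\<^bsub>i \<in> I\<^esub> deg i\<close>, so a component of a cycle of fixed total degree is a cycle.\<close>

lemma koszul_linked_component:
  fixes K :: "'g::ab_group_add \<Rightarrow> 'a \<Rightarrow> 'a" and deg :: "nat \<Rightarrow> 'g"
  assumes "koszul_linked a A B p s t" "finite A" "finite B"
    and KP: "\<And>c b. b \<in> P \<Longrightarrow> K c b \<in> P"
    and Kadd: "\<And>c b b'. K c (b + b') = K c b + K c b'"
    and Kmult: "\<And>c i b. i \<in> A \<union> B \<Longrightarrow> b \<in> P \<Longrightarrow> K (c + deg i) (a i * b) = a i * K c b"
  shows "koszul_linked a A B p (K c s) (K (c + sum deg A - sum deg B) t)"
proof -
  obtain z where z: "\<And>I. z I \<in> P" "\<And>I. I \<subseteq> A \<union> B \<Longrightarrow> Suc (card I) = p \<Longrightarrow> koszul_bd a (A \<union> B) z I = 0"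
    "z A = s" "z B = t"
    using assms(1) unfolding koszul_linked_def by blast
  have K0: "K c 0 = 0" for c using Kadd[of c 0 0] by simp
  have Kneg: "K c (- b) = - K c b" for c b
    using Kadd[of c b "- b"] K0[of c] by (simp add: eq_neg_iff_add_eq_0 add.commute)
  have Ksum: "K c (sum g I) = (\<Sum>i\<in>I. K c (g i))" for c I and g :: "nat \<Rightarrow> 'a"
    by (induction I rule: infinite_finite_induct) (auto simp: K0 Kadd)
  have sgn: "koszul_sign i I = (1::'a) \<or> koszul_sign i I = (- 1::'a)" for i I
    by (simp add: koszul_sign_def minus_one_power_iff)
  have Ksgn: "K c (koszul_sign i I * b) = koszul_sign i I * K c b" for c i I b
    using sgn[of i I] Kneg by auto
  define e where "e = c + sum deg A"
  \<comment> \<open>The component of total degree \<open>e\<close>; at \<open>A\<close> it is the component of degree \<open>c\<close>.\<close>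
  define z' where "z' I = K (e - sum deg I) (z I)" for I
  have "koszul_bd a (A \<union> B) z' I = 0" if I: "I \<subseteq> A \<union> B" "Suc (card I) = p" for I
  proof -
    have fI: "finite I" using I assms finite_subset by blast
    have "koszul_bd a (A \<union> B) z' I = (\<Sum>i\<in>A \<union> B - I. K (e - sum deg I) (koszul_sign i I * a i * z (insert i I)))"
      unfolding koszul_bd_def
    proof (intro sum.cong refl)
      fix i assume i: "i \<in> A \<union> B - I"
      then have "e - sum deg I = e - sum deg (insert i I) + deg i" using fI by simp
      then have "a i * z' (insert i I) = K (e - sum deg I) (a i * z (insert i I))"
        unfolding z'_def using Kmult[of i "z (insert i I)" "e - sum deg (insert i I)"] i z(1)
        by (simp only: Diff_iff)
      then show "koszul_sign i I * a i * z' (insert i I) = K (e - sum deg I) (koszul_sign i I * a i * z (insert i I))"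
        by (simp add: mult.assoc Ksgn)
    qed
    also have "\<dots> = K (e - sum deg I) (koszul_bd a (A \<union> B) z I)"
      by (simp add: koszul_bd_def Ksum)
    finally show ?thesis using z(2)[OF I] K0 by simp
  qed
  moreover have "z' I \<in> P" for I by (simp add: z'_def KP z)
  moreover have "z' A = K c s" "z' B = K (c + sum deg A - sum deg B) t"
    by (simp_all add: z'_def e_def z)
  ultimately show ?thesis unfolding koszul_linked_def by blast
qed

end

section \<open>Coefficients, graded components and monomials\<close>

abbreviation coeff :: "('a \<Rightarrow>\<^sub>0 'b::zero) \<Rightarrow> 'a \<Rightarrow> 'b" where
  "coeff \<equiv> Poly_Mapping.lookup"
abbreviation support :: "('a \<Rightarrow>\<^sub>0 'b::zero) \<Rightarrow> 'a set" where
  "support \<equiv> Poly_Mapping.keys"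
abbreviation monomial :: "'a \<Rightarrow> 'b \<Rightarrow> 'a \<Rightarrow>\<^sub>0 'b::zero" where
  "monomial \<equiv> Poly_Mapping.single"

definition restrict_support :: "('a \<Rightarrow> bool) \<Rightarrow> ('a \<Rightarrow>\<^sub>0 'b::zero) \<Rightarrow> ('a \<Rightarrow>\<^sub>0 'b)" where
  "restrict_support Q p = Poly_Mapping.mapp (\<lambda>m c. if Q m then c else 0) p"

lemma coeff_restrict_support: "coeff (restrict_support Q p) m = (if Q m then coeff p m else 0)"
  by (auto simp: restrict_support_def lookup_mapp when_def in_keys_iff)

lemma support_restrict_support: "support (restrict_support Q p) = {m \<in> support p. Q m}"
  by (auto simp: in_keys_iff coeff_restrict_support split: if_splits)

lemma restrict_support_add:
  fixes p :: "'a \<Rightarrow>\<^sub>0 'b::comm_monoid_add"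
  shows "restrict_support Q (p + q) = restrict_support Q p + restrict_support Q q"
  by (rule poly_mapping_eqI) (simp add: coeff_restrict_support lookup_add)

lemma monomial_expansion: "p = (\<Sum>m\<in>support p. monomial m (coeff p m))"
proof (rule poly_mapping_eqI)
  fix k
  have "coeff (\<Sum>m\<in>support p. monomial m (coeff p m)) k = (\<Sum>m\<in>support p. if m = k then coeff p m else 0)"
    unfolding lookup_sum by (intro sum.cong) (auto simp: lookup_single when_def)
  also have "\<dots> = coeff p k"
    by (simp add: sum.delta in_keys_iff)
  finally show "coeff p k = coeff (\<Sum>m\<in>support p. monomial m (coeff p m)) k" by simp
qed

lemma coeff_monomial_mult:
  fixes p :: "'a::cancel_comm_monoid_add \<Rightarrow>\<^sub>0 'b::comm_semiring_0"
  shows "coeff (monomial m c * p) (m + k) = c * coeff p k"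
proof -
  have "coeff (monomial m c * p) (m + k) = (\<Sum>l. coeff (monomial m c) l * (\<Sum>q. coeff p q when m + k = l + q))"
    by (rule lookup_mult)
  also have "\<dots> = (\<Sum>l. (c * (\<Sum>q. coeff p q when m + k = l + q)) when l = m)"
    by (intro Sum_any.cong) (auto simp: lookup_single when_def)
  also have "\<dots> = c * (\<Sum>q. coeff p q when k = q)"
    by simp
  finally show ?thesis by simp
qed

lemma coeff_monomial_mult_eq_0:
  fixes p :: "'a::cancel_comm_monoid_add \<Rightarrow>\<^sub>0 'b::comm_semiring_0"
  assumes "\<And>k. n \<noteq> m + k"
  shows "coeff (monomial m c * p) n = 0"
proof -
  have "n \<notin> support (monomial m c * p)"
    using keys_mult[of "monomial m c" p] assms by (auto split: if_splits)
  then show ?thesis by (simp add: in_keys_iff)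
qed

lemma exponent_divides_iff:
  fixes m k :: "'a \<Rightarrow>\<^sub>0 nat"
  shows "(\<exists>l. k = m + l) \<longleftrightarrow> (\<forall>v. coeff m v \<le> coeff k v)"
proof
  assume "\<forall>v. coeff m v \<le> coeff k v"
  then have "k = m + (k - m)"
    by (intro poly_mapping_eqI) (simp add: lookup_add lookup_minus)
  then show "\<exists>l. k = m + l" ..
qed (auto simp: lookup_add)

lemma support_add_exponents:
  fixes m k :: "'a \<Rightarrow>\<^sub>0 nat"
  shows "support (m + k) = support m \<union> support k"
  by (auto simp: in_keys_iff lookup_add)

lemma comm_subring_mpolys: "comm_subring (mpolys V :: 'k::field mpoly set)"
proof
  fix p q :: "'k mpoly" assume pq: "p \<in> mpolys V" "q \<in> mpolys V"
  show "p + q \<in> mpolys V"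
    using pq keys_add[of p q] by (auto simp: mpolys_def)
  show "p * q \<in> mpolys V"
    using pq keys_mult[of p q] by (fastforce simp: mpolys_def support_add_exponents)
qed (auto simp: mpolys_def in_keys_iff)

lemma monomial_mem_mpolys: "support m \<subseteq> V \<Longrightarrow> monomial m c \<in> mpolys V"
  by (auto simp: mpolys_def)

lemma xdeg_eq_superset:
  assumes "finite A" "support m \<subseteq> A"
  shows "xdeg m = (\<Sum>v\<in>A. case v of Xv i \<Rightarrow> coeff m v | Yv j \<Rightarrow> 0)"
  unfolding xdeg_def using assms
  by (intro sum.mono_neutral_left) (auto simp: in_keys_iff split: var.splits)

lemma ydeg_eq_superset:
  assumes "finite A" "support m \<subseteq> A"
  shows "ydeg m = (\<Sum>v\<in>A. case v of Xv i \<Rightarrow> 0 | Yv j \<Rightarrow> coeff m v)"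
  unfolding ydeg_def using assms
  by (intro sum.mono_neutral_left) (auto simp: in_keys_iff split: var.splits)

lemma xdeg_add: "xdeg (m + k) = xdeg m + xdeg k"
proof -
  let ?A = "support m \<union> support k"
  show ?thesis
    using xdeg_eq_superset[of ?A "m + k"] xdeg_eq_superset[of ?A m] xdeg_eq_superset[of ?A k]
    by (simp add: support_add_exponents sum.distrib[symmetric])
      (intro sum.cong, auto simp: lookup_add split: var.splits)
qed

lemma ydeg_add: "ydeg (m + k) = ydeg m + ydeg k"
proof -
  let ?A = "support m \<union> support k"
  show ?thesis
    using ydeg_eq_superset[of ?A "m + k"] ydeg_eq_superset[of ?A m] ydeg_eq_superset[of ?A k]
    by (simp add: support_add_exponents sum.distrib[symmetric])
      (intro sum.cong, auto simp: lookup_add split: var.splits)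
qed

definition bihomogeneous :: "int \<Rightarrow> int \<Rightarrow> 'k::field mpoly \<Rightarrow> bool" where
  "bihomogeneous i j p \<longleftrightarrow> (\<forall>m\<in>support p. int (xdeg m) = i \<and> int (ydeg m) = j)"

definition component :: "int \<times> int \<Rightarrow> 'k::field mpoly \<Rightarrow> 'k mpoly" where
  "component c p = restrict_support (\<lambda>m. (int (xdeg m), int (ydeg m)) = c) p"

lemma bihomogeneous_0 [simp]: "bihomogeneous i j 0"
  by (simp add: bihomogeneous_def)

lemma bihomogeneous_add: "bihomogeneous i j p \<Longrightarrow> bihomogeneous i j q \<Longrightarrow> bihomogeneous i j (p + q)"
  using keys_add[of p q] by (auto simp: bihomogeneous_def)

lemma bihomogeneous_sum: "(\<And>x. x \<in> A \<Longrightarrow> bihomogeneous i j (g x)) \<Longrightarrow> bihomogeneous i j (sum g A)"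
  by (induction A rule: infinite_finite_induct) (auto intro: bihomogeneous_add)

lemma bihomogeneous_mult:
  "bihomogeneous i j p \<Longrightarrow> bihomogeneous i' j' q \<Longrightarrow> bihomogeneous (i + i') (j + j') (p * q)"
  using keys_mult[of p q] by (fastforce simp: bihomogeneous_def xdeg_add ydeg_add)

lemma bihomogeneous_negative: "bihomogeneous i j p \<Longrightarrow> i < 0 \<Longrightarrow> p = 0"
  by (auto simp: bihomogeneous_def simp flip: keys_eq_empty)

lemma bihomogeneous_component: "bihomogeneous (fst c) (snd c) (component c p)"
  by (auto simp: bihomogeneous_def component_def support_restrict_support)

lemma component_eq_self: "bihomogeneous i j p \<Longrightarrow> component (i, j) p = p"
  by (rule poly_mapping_eqI) (auto simp: bihomogeneous_def component_def coeff_restrict_support in_keys_iff)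

lemma component_mem: "p \<in> mpolys V \<Longrightarrow> component c p \<in> mpolys V"
  by (auto simp: mpolys_def component_def support_restrict_support)

lemma component_add: "component c (p + q) = component c p + component c q"
  by (simp add: component_def restrict_support_add)

lemma component_sum: "component c (sum g A) = (\<Sum>x\<in>A. component c (g x))"
  by (induction A rule: infinite_finite_induct)
    (auto simp: component_add, auto intro: poly_mapping_eqI simp: component_def coeff_restrict_support)

lemma component_expansion:
  "p = (\<Sum>c\<in>(\<lambda>m. (int (xdeg m), int (ydeg m))) ` support p. component c p)"
proof (rule poly_mapping_eqI)
  fix k
  let ?d = "\<lambda>m. (int (xdeg m), int (ydeg m))"
  have "coeff (\<Sum>c\<in>?d ` support p. component c p) k = (\<Sum>c\<in>?d ` support p. if c = ?d k then coeff p k else 0)"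
    unfolding lookup_sum by (intro sum.cong) (auto simp: component_def coeff_restrict_support)
  also have "\<dots> = coeff p k"
    by (auto simp: sum.delta in_keys_iff)
  finally show "coeff p k = coeff (\<Sum>c\<in>?d ` support p. component c p) k" by simp
qed

lemma component_mult:
  assumes "bihomogeneous i j a"
  shows "component (c + (i, j)) (a * b) = a * component c b"
proof -
  have mono: "component (c + (int (xdeg m), int (ydeg m))) (monomial m x * b) = monomial m x * component c b" for m x
  proof (rule poly_mapping_eqI)
    fix k
    show "coeff (component (c + (int (xdeg m), int (ydeg m))) (monomial m x * b)) k = coeff (monomial m x * component c b) k"
    proof (cases "\<exists>l. k = m + l")
      case True
      then obtain l where k: "k = m + l" by blast
      show ?thesis
        by (cases c) (auto simp: k component_def coeff_restrict_support coeff_monomial_mult xdeg_add ydeg_add)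
    next
      case False
      then show ?thesis
        by (simp add: component_def coeff_restrict_support coeff_monomial_mult_eq_0)
    qed
  qed
  have "component (c + (i, j)) (a * b) = component (c + (i, j)) (\<Sum>m\<in>support a. monomial m (coeff a m) * b)"
    by (subst monomial_expansion[of a]) (simp add: sum_distrib_right)
  also have "\<dots> = (\<Sum>m\<in>support a. monomial m (coeff a m) * component c b)"
    unfolding component_sum
  proof (intro sum.cong refl)
    fix m assume "m \<in> support a"
    then have "(i, j) = (int (xdeg m), int (ydeg m))"
      using assms by (auto simp: bihomogeneous_def)
    then show "component (c + (i, j)) (monomial m (coeff a m) * b) = monomial m (coeff a m) * component c b"
      by (simp only: mono)
  qed
  also have "\<dots> = a * component c b"
    by (subst (3) monomial_expansion[of a]) (simp add: sum_distrib_right)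
  finally show ?thesis .
qed

definition xmonomial :: "nat \<Rightarrow> (nat \<Rightarrow> nat) \<Rightarrow> var \<Rightarrow>\<^sub>0 nat" where
  "xmonomial d q = (\<Sum>i<d. monomial (Xv i) (q i))"

lemma coeff_xmonomial_X: "coeff (xmonomial d q) (Xv i) = (if i < d then q i else 0)"
proof -
  have "coeff (xmonomial d q) (Xv i) = (\<Sum>j<d. if j = i then q j else 0)"
    unfolding xmonomial_def lookup_sum by (intro sum.cong) (auto simp: lookup_single when_def)
  then show ?thesis by (simp add: sum.delta)
qed

lemma coeff_xmonomial_Y: "coeff (xmonomial d q) (Yv i) = 0"
  unfolding xmonomial_def lookup_sum by (simp add: lookup_single when_def)

lemma support_xmonomial: "support (xmonomial d q) \<subseteq> Xv ` {..<d}"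
proof
  fix v assume "v \<in> support (xmonomial d q)"
  then show "v \<in> Xv ` {..<d}"
    by (cases v) (auto simp: in_keys_iff coeff_xmonomial_X coeff_xmonomial_Y split: if_splits)
qed

lemma xdeg_of_support:
  assumes "support m \<subseteq> Xv ` {..<d} \<union> range Yv"
  shows "xdeg m = (\<Sum>i<d. coeff m (Xv i))"
proof -
  have "xdeg m = (\<Sum>v\<in>Xv ` {..<d} \<union> support m. case v of Xv i \<Rightarrow> coeff m v | Yv j \<Rightarrow> 0)"
    by (intro xdeg_eq_superset) auto
  also have "\<dots> = (\<Sum>v\<in>Xv ` {..<d}. case v of Xv i \<Rightarrow> coeff m v | Yv j \<Rightarrow> 0)"
    using assms by (intro sum.mono_neutral_right) auto
  also have "\<dots> = (\<Sum>i<d. coeff m (Xv i))"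
    by (subst sum.reindex) (auto simp: inj_on_def)
  finally show ?thesis .
qed

lemma ydeg_eq_0: "support m \<subseteq> range Xv \<Longrightarrow> ydeg m = 0"
  unfolding ydeg_def by (intro sum.neutral) auto

lemma xdeg_eq_0: "support m \<subseteq> range Yv \<Longrightarrow> xdeg m = 0"
  unfolding xdeg_def by (intro sum.neutral) auto

lemma xdeg_xmonomial: "xdeg (xmonomial d q) = (\<Sum>i<d. q i)"
  using support_xmonomial[of d q] by (subst xdeg_of_support[of _ d]) (auto simp: coeff_xmonomial_X)

lemma ydeg_xmonomial: "ydeg (xmonomial d q) = 0"
  using support_xmonomial[of d q] by (intro ydeg_eq_0) auto

definition ypart :: "(var \<Rightarrow>\<^sub>0 nat) \<Rightarrow> (var \<Rightarrow>\<^sub>0 nat)" where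
  "ypart m = restrict_support (\<lambda>v. v \<in> range Yv) m"

lemma support_ypart: "support (ypart m) = support m \<inter> range Yv"
  by (auto simp: ypart_def support_restrict_support)

lemma exponent_split:
  assumes "support m \<subseteq> Xv ` {..<d} \<union> range Yv"
  shows "m = ypart m + xmonomial d (\<lambda>i. coeff m (Xv i))"
proof (rule poly_mapping_eqI)
  fix v
  show "coeff m v = coeff (ypart m + xmonomial d (\<lambda>i. coeff m (Xv i))) v"
    using assms
    by (cases v) (auto simp: lookup_add ypart_def coeff_restrict_support coeff_xmonomial_X coeff_xmonomial_Y in_keys_iff)
qed

text \<open>The coefficient of \<open>(x\<^sub>0 \<cdots> x\<^sub>d\<^sub>-\<^sub>1)\<^sup>N\<^sup>-\<^sup>1\<close> of a polynomial in the \<open>x\<^sub>i\<close> over \<open>T\<close>.\<close>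

definition top_coeff :: "nat \<Rightarrow> nat \<Rightarrow> 'k::field mpoly \<Rightarrow> 'k mpoly" where
  "top_coeff d N p = restrict_support (\<lambda>m. support m \<subseteq> range Yv)
     (Poly_Mapping.map_key (\<lambda>m. m + xmonomial d (\<lambda>_. N - 1)) p)"

lemma coeff_top_coeff:
  "coeff (top_coeff d N p) m =
    (if support m \<subseteq> range Yv then coeff p (m + xmonomial d (\<lambda>_. N - 1)) else 0)"
proof -
  have "inj (\<lambda>m. m + xmonomial d (\<lambda>_. N - 1))" by (simp add: inj_def)
  then show ?thesis by (simp add: top_coeff_def coeff_restrict_support map_key.rep_eq)
qed

lemma top_coeff_add: "top_coeff d N (p + q) = top_coeff d N p + top_coeff d N q"
  by (rule poly_mapping_eqI) (simp add: coeff_top_coeff lookup_add)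

lemma top_coeff_0 [simp]: "top_coeff d N 0 = 0"
  by (rule poly_mapping_eqI) (simp add: coeff_top_coeff)

lemma top_coeff_diff: "top_coeff d N (p - q) = top_coeff d N p - top_coeff d N q"
  by (rule poly_mapping_eqI) (simp add: coeff_top_coeff lookup_minus)

lemma top_coeff_sum: "top_coeff d N (sum g A) = (\<Sum>x\<in>A. top_coeff d N (g x))"
  by (induction A rule: infinite_finite_induct) (auto simp: top_coeff_add)

lemma support_top_coeff:
  "m \<in> support (top_coeff d N p) \<Longrightarrow> support m \<subseteq> range Yv \<and> m + xmonomial d (\<lambda>_. N - 1) \<in> support p"
  by (auto simp: in_keys_iff coeff_top_coeff split: if_splits)

lemma top_coeff_mem:
  assumes "p \<in> mpolys (Xv ` {..<d} \<union> Yv ` {..<n})"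
  shows "top_coeff d N p \<in> mpolys (Yv ` {..<n})"
  unfolding mpolys_def
proof (intro CollectI ballI)
  fix m assume "m \<in> support (top_coeff d N p)"
  then have "support m \<subseteq> range Yv" "support m \<subseteq> Xv ` {..<d} \<union> Yv ` {..<n}"
    using support_top_coeff[of m d N p] assms by (force simp: mpolys_def support_add_exponents)+
  then show "support m \<subseteq> Yv ` {..<n}" by auto
qed

lemma bihomogeneous_top_coeff:
  assumes "bihomogeneous i j p"
  shows "bihomogeneous (i - int (d * (N - 1))) j (top_coeff d N p)"
  unfolding bihomogeneous_def
proof
  fix m assume "m \<in> support (top_coeff d N p)"
  then have "m + xmonomial d (\<lambda>_. N - 1) \<in> support p" using support_top_coeff by blast
  then have "int (xdeg m) + int (xdeg (xmonomial d (\<lambda>_. N - 1))) = i" "int (ydeg m) = j"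
    using assms by (auto simp: bihomogeneous_def xdeg_add ydeg_add ydeg_xmonomial)
  then show "int (xdeg m) = i - int (d * (N - 1)) \<and> int (ydeg m) = j"
    by (simp add: xdeg_xmonomial)
qed

text \<open>Multiplication by the top monomial in the \<open>x\<^sub>i\<close> changes no exponent of a \<open>y\<^sub>j\<close> and so does not affect
divisibility by monomials in the \<open>y\<^sub>j\<close>.\<close>

lemma top_coeff_mult_Y:
  assumes "y \<in> mpolys (range Yv)"
  shows "top_coeff d N (y * p) = y * top_coeff d N p"
proof -
  have mono: "top_coeff d N (monomial m c * p) = monomial m c * top_coeff d N p"
    if m: "support m \<subseteq> range Yv" for m c
  proof (rule poly_mapping_eqI)
    fix k
    let ?t = "xmonomial d (\<lambda>_. N - 1)"
    show "coeff (top_coeff d N (monomial m c * p)) k = coeff (monomial m c * top_coeff d N p) k"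
    proof (cases "\<exists>l. k = m + l")
      case True
      then obtain l where k: "k = m + l" by blast
      show ?thesis
        using m coeff_monomial_mult[of m c p "l + ?t"]
        by (simp add: k coeff_top_coeff coeff_monomial_mult support_add_exponents add.assoc)
    next
      case False
      then obtain v where v: "coeff k v < coeff m v" using exponent_divides_iff[of k m] by (auto simp: not_le)
      then have "v \<in> support m" by (auto simp: in_keys_iff)
      then have "coeff ?t v = 0" using m by (auto simp: coeff_xmonomial_Y)
      then have "\<nexists>l. k + ?t = m + l"
        using v exponent_divides_iff[of "k + ?t" m] by (metis add.right_neutral lookup_add not_le)
      then show ?thesis
        using False by (simp add: coeff_top_coeff coeff_monomial_mult_eq_0)
    qed
  qed
  have "top_coeff d N (y * p) = top_coeff d N (\<Sum>m\<in>support y. monomial m (coeff y m) * p)"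
    by (subst monomial_expansion[of y]) (simp add: sum_distrib_right)
  also have "\<dots> = (\<Sum>m\<in>support y. monomial m (coeff y m) * top_coeff d N p)"
    unfolding top_coeff_sum using assms by (intro sum.cong refl mono) (auto simp: mpolys_def)
  also have "\<dots> = y * top_coeff d N p"
    by (subst (3) monomial_expansion[of y]) (simp add: sum_distrib_right)
  finally show ?thesis .
qed

lemma top_coeff_xmonomial:
  assumes "\<And>i. i < d \<Longrightarrow> r i = N - 1"
  shows "top_coeff d N (monomial (xmonomial d r) 1) = 1"
proof -
  have e: "xmonomial d r = xmonomial d (\<lambda>_. N - 1)"
    using assms by (simp add: xmonomial_def)
  show ?thesis
    by (rule poly_mapping_eqI) (auto simp: e coeff_top_coeff lookup_single lookup_one when_def)
qed

lemma top_coeff_eq_0: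
  assumes "\<And>m. m \<in> support p \<Longrightarrow> \<exists>j<d. coeff m (Xv j) \<noteq> N - 1"
  shows "top_coeff d N p = 0"
proof (rule poly_mapping_eqI)
  fix m
  show "coeff (top_coeff d N p) m = coeff 0 m"
  proof (cases "support m \<subseteq> range Yv")
    case True
    have "m + xmonomial d (\<lambda>_. N - 1) \<notin> support p"
    proof
      assume "m + xmonomial d (\<lambda>_. N - 1) \<in> support p"
      then obtain j where j: "j < d" "coeff m (Xv j) + (N - 1) \<noteq> N - 1"
        using assms by (force simp: lookup_add coeff_xmonomial_X)
      then have "Xv j \<in> support m" by (auto simp: in_keys_iff)
      then show False using True by auto
    qed
    then show ?thesis by (simp add: coeff_top_coeff in_keys_iff)
  qed (simp add: coeff_top_coeff)
qed


section \<open>The ideal of \<open>N\<close>-th powers of the variables and its dual\<close>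

text \<open>The carriers of \<open>B\<close> and \<open>T\<close> are parameters because the field \<open>k\<close> occurs only in their types.\<close>

locale xy_ring =
  fixes d n :: nat and P T :: "'k::field mpoly set"
  assumes P_eq: "P = mpolys (Xv ` {..<d} \<union> Yv ` {..<n})" and T_eq: "T = mpolys (Yv ` {..<n})"

sublocale xy_ring \<subseteq> comm_subring P
  unfolding P_eq by (rule comm_subring_mpolys)

context xy_ring
begin

lemma T_subset: "T \<subseteq> P" "T \<subseteq> mpolys (range Yv)"
  unfolding P_eq T_eq mpolys_def by blast+

lemma support_P: "p \<in> P \<Longrightarrow> m \<in> support p \<Longrightarrow> support m \<subseteq> Xv ` {..<d} \<union> range Yv"
  unfolding P_eq mpolys_def by blast

abbreviation xpower :: "nat \<Rightarrow> nat \<Rightarrow> 'k mpoly" where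
  "xpower N j \<equiv> monomial (monomial (Xv j) N) 1"

lemma xpower_mem: "j < d \<Longrightarrow> xpower N j \<in> P"
  unfolding P_eq by (intro monomial_mem_mpolys) auto

lemma coeff_xpower_exponent: "coeff (monomial (Xv j) N) (Xv i) = (if i = j then N else 0)"
  by (auto simp: lookup_single when_def)

text \<open>Membership in an ideal generated by monomials is decided on each monomial separately. The function \<open>e\<close>
allows for generators that are indexed with an offset.\<close>

lemma span_xpowers_iff:
  assumes I: "finite I" and e: "\<And>i. i \<in> I \<Longrightarrow> e i < d" and a: "\<And>i. i \<in> I \<Longrightarrow> a i = xpower N (e i)"
  shows "p \<in> span_ideal a I \<longleftrightarrow> p \<in> P \<and> (\<forall>m\<in>support p. \<exists>i\<in>I. N \<le> coeff m (Xv (e i)))"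
proof
  have aP: "a i \<in> P" if "i \<in> I" for i using that a e xpower_mem by simp
  have J: "ideal_in (span_ideal a I)" by (intro ideal_in_span_ideal aP)
  {
    assume p: "p \<in> span_ideal a I"
    then obtain c where c: "p = (\<Sum>i\<in>I. c i * a i)" by (metis span_idealE)
    have "\<exists>i\<in>I. N \<le> coeff m (Xv (e i))" if "m \<in> support p" for m
    proof -
      obtain i where i: "i \<in> I" "m \<in> support (c i * a i)"
        using \<open>m \<in> support p\<close> keys_sum[of "\<lambda>i. c i * a i" I] c by auto
      then obtain k l where "m = k + l" "l \<in> support (xpower N (e i))"
        using keys_mult[of "c i" "a i"] a by auto
      then show ?thesis
        using i by (intro bexI[of _ i]) (auto simp: lookup_add coeff_xpower_exponent)
    qed
    then show "p \<in> P \<and> (\<forall>m\<in>support p. \<exists>i\<in>I. N \<le> coeff m (Xv (e i)))"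
      using p ideal_in_subset[OF J] by blast
  next
    assume p: "p \<in> P \<and> (\<forall>m\<in>support p. \<exists>i\<in>I. N \<le> coeff m (Xv (e i)))"
    have "monomial m (coeff p m) \<in> span_ideal a I" if m: "m \<in> support p" for m
    proof -
      obtain i where i: "i \<in> I" "N \<le> coeff m (Xv (e i))" using p m by blast
      then have "\<exists>l. m = monomial (Xv (e i)) N + l"
        unfolding exponent_divides_iff by (auto simp: lookup_single when_def)
      then obtain l where l: "m = monomial (Xv (e i)) N + l" by blast
      have "support m \<subseteq> Xv ` {..<d} \<union> Yv ` {..<n}" using p m by (auto simp: P_eq mpolys_def)
      then have "monomial l (coeff p m) \<in> P"
        unfolding P_eq by (intro monomial_mem_mpolys) (auto simp: l support_add_exponents)
      then have "monomial l (coeff p m) * a i \<in> span_ideal a I"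
        using i I by (intro ideal_in_mult[OF J] span_ideal_generator)
      then show ?thesis
        using i a by (simp add: mult_single l add.commute)
    qed
    then have "(\<Sum>m\<in>support p. monomial m (coeff p m)) \<in> span_ideal a I"
      by (intro ideal_in_sum[OF J])
    then show "p \<in> span_ideal a I" by (simp flip: monomial_expansion)
  }
qed

text \<open>Multiplication by \<open>x\<^sub>j\<^sup>N\<close> leaves the exponents of the earlier variables unchanged.\<close>

lemma regular_on_xpowers:
  assumes a: "\<And>j. j < d \<Longrightarrow> a (s + j) = xpower N j"
  shows "regular_on a s d"
  unfolding regular_on_def nonzerodivisor_mod_def
proof (intro allI ballI impI)
  fix j b assume j: "j < d" and b: "b \<in> P" "a (s + j) * b \<in> span_ideal a {s..<s + j}"
  have iff: "p \<in> span_ideal a {s..<s + j} \<longleftrightarrow>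
      p \<in> P \<and> (\<forall>m\<in>support p. \<exists>i\<in>{s..<s + j}. N \<le> coeff m (Xv (i - s)))" for p
  proof (rule span_xpowers_iff)
    fix i assume "i \<in> {s..<s + j}"
    then show "i - s < d" "a i = xpower N (i - s)"
      using j a[of "i - s"] by auto
  qed simp
  have "\<exists>i\<in>{s..<s + j}. N \<le> coeff m (Xv (i - s))" if m: "m \<in> support b" for m
  proof -
    have "coeff (a (s + j) * b) (monomial (Xv j) N + m) = coeff b m"
      using a[OF j] by (simp add: coeff_monomial_mult)
    then have "monomial (Xv j) N + m \<in> support (a (s + j) * b)"
      using m by (simp add: in_keys_iff)
    then obtain i where "i \<in> {s..<s + j}" "N \<le> coeff (monomial (Xv j) N + m) (Xv (i - s))"
      using b iff by blast
    then show ?thesis by (intro bexI[of _ i]) (auto simp: lookup_add coeff_xpower_exponent split: if_splits)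
  qed
  then show "b \<in> span_ideal a {s..<s + j}" using b iff by blast
qed

definition xpower_ideal :: "nat \<Rightarrow> 'k mpoly set" where
  "xpower_ideal N = {p \<in> P. \<forall>m\<in>support p. \<exists>j<d. N \<le> coeff m (Xv j)}"

lemma span_xpowers_eq:
  assumes a: "\<And>j. j < d \<Longrightarrow> a (s + j) = xpower N j"
  shows "span_ideal a {s..<s + d} = xpower_ideal N"
proof -
  have "p \<in> span_ideal a {s..<s + d} \<longleftrightarrow>
      p \<in> P \<and> (\<forall>m\<in>support p. \<exists>i\<in>{s..<s + d}. N \<le> coeff m (Xv (i - s)))" for p
  proof (rule span_xpowers_iff)
    fix i assume "i \<in> {s..<s + d}"
    then show "i - s < d" "a i = xpower N (i - s)"
      using a[of "i - s"] by auto
  qed simp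
  moreover have "(\<exists>i\<in>{s..<s + d}. N \<le> coeff m (Xv (i - s))) \<longleftrightarrow> (\<exists>j<d. N \<le> coeff m (Xv j))" for m
  proof
    assume "\<exists>j<d. N \<le> coeff m (Xv j)"
    then obtain j where "j < d" "N \<le> coeff m (Xv j)" by blast
    then show "\<exists>i\<in>{s..<s + d}. N \<le> coeff m (Xv (i - s))" by (intro bexI[of _ "s + j"]) auto
  next
    assume "\<exists>i\<in>{s..<s + d}. N \<le> coeff m (Xv (i - s))"
    then obtain i where "i \<in> {s..<s + d}" "N \<le> coeff m (Xv (i - s))" by blast
    then show "\<exists>j<d. N \<le> coeff m (Xv j)" by (intro exI[of _ "i - s"]) auto
  qed
  ultimately show ?thesis by (auto simp: xpower_ideal_def)
qed

lemma span_xpowers_eq_0: "span_ideal (xpower N) {0..<0 + d} = xpower_ideal N"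
  by (rule span_xpowers_eq) (simp only: add_0)

lemma ideal_in_xpower_ideal: "ideal_in (xpower_ideal N)"
  unfolding span_xpowers_eq_0[symmetric] by (rule ideal_in_span_ideal) (simp add: xpower_mem)

lemma xpower_in_xpower_ideal:
  assumes "j < d" "b \<in> P"
  shows "xpower N j * b \<in> xpower_ideal N"
proof -
  have "xpower N j \<in> xpower_ideal N"
    unfolding span_xpowers_eq_0[symmetric]
    by (rule span_ideal_generator[of _ _ "xpower N"]) (use assms in auto)
  then show ?thesis
    using ideal_in_mult[OF ideal_in_xpower_ideal assms(2)] by (subst mult.commute)
qed

text \<open>By the pigeonhole principle: \<open>d\<close> exponents below \<open>N\<close> add up to at most \<open>d (N - 1)\<close>.\<close>

lemma high_degree_in_xpower_ideal:
  assumes p: "p \<in> P" and deg: "\<And>m. m \<in> support p \<Longrightarrow> xdeg m > d * (N - 1)"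
  shows "p \<in> xpower_ideal N"
  unfolding xpower_ideal_def
proof (intro CollectI conjI ballI p)
  fix m assume m: "m \<in> support p"
  have "xdeg m = (\<Sum>i<d. coeff m (Xv i))"
    using p m by (intro xdeg_of_support support_P)
  then have "(\<Sum>i<d. coeff m (Xv i)) > d * (N - 1)" using deg[OF m] by simp
  moreover have "(\<Sum>i<d. coeff m (Xv i)) \<le> d * (N - 1)" if "\<And>i. i < d \<Longrightarrow> coeff m (Xv i) \<le> N - 1"
    using sum_bounded_above[of "{..<d}" "\<lambda>i. coeff m (Xv i)" "N - 1"] that by simp
  ultimately obtain k where "k < d" "coeff m (Xv k) > N - 1" using not_le by blast
  then show "\<exists>j<d. N \<le> coeff m (Xv j)" by (intro exI[of _ k]) auto
qed

lemma top_coeff_xpower_ideal: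
  assumes "N > 0" "p \<in> xpower_ideal N"
  shows "top_coeff d N p = 0"
proof (rule top_coeff_eq_0)
  fix m assume "m \<in> support p"
  then obtain j where "j < d" "N \<le> coeff m (Xv j)" using assms by (auto simp: xpower_ideal_def)
  then show "\<exists>j<d. coeff m (Xv j) \<noteq> N - 1" using assms by (intro exI[of _ j]) auto
qed

text \<open>This lemma and the next one say that \<open>(p, b) \<mapsto> top_coeff d N (p * b)\<close> is a perfect pairing over \<open>T\<close> on
\<open>B / (x\<^sub>0\<^sup>N, \<dots>, x\<^sub>d\<^sub>-\<^sub>1\<^sup>N)\<close>.\<close>

lemma top_coeff_nondegenerate:
  assumes p: "p \<in> P" and 0: "\<And>b. b \<in> P \<Longrightarrow> top_coeff d N (p * b) = 0"
  shows "p \<in> xpower_ideal N"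
proof (rule ccontr)
  assume "p \<notin> xpower_ideal N"
  then obtain m where m: "m \<in> support p" "\<And>j. j < d \<Longrightarrow> coeff m (Xv j) < N"
    using p by (auto simp: xpower_ideal_def not_le)
  let ?k = "xmonomial d (\<lambda>i. N - 1 - coeff m (Xv i))"
  have supp: "support m \<subseteq> Xv ` {..<d} \<union> range Yv" using p m by (intro support_P)
  \<comment> \<open>Multiplication with the complementary monomial moves \<open>m\<close> into top position.\<close>
  have "?k + m = ypart m + xmonomial d (\<lambda>_. N - 1)"
  proof (rule poly_mapping_eqI)
    fix v
    show "coeff (?k + m) v = coeff (ypart m + xmonomial d (\<lambda>_. N - 1)) v"
    proof (cases v)
      case (Xv i)
      then show ?thesis
        using m(2)[of i] supp by (cases "i < d")
          (auto simp: lookup_add coeff_xmonomial_X ypart_def coeff_restrict_support in_keys_iff)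
    qed (simp add: lookup_add coeff_xmonomial_Y ypart_def coeff_restrict_support)
  qed
  then have "coeff (top_coeff d N (monomial ?k 1 * p)) (ypart m) = coeff (monomial ?k 1 * p) (?k + m)"
    by (simp add: coeff_top_coeff support_ypart)
  also have "\<dots> = coeff p m" by (simp add: coeff_monomial_mult)
  finally have "coeff (top_coeff d N (monomial ?k 1 * p)) (ypart m) \<noteq> 0" using m by (simp add: in_keys_iff)
  moreover have "monomial ?k 1 \<in> P"
    unfolding P_eq using support_xmonomial by (intro monomial_mem_mpolys) blast
  ultimately show False using 0[of "monomial ?k 1"] by (simp add: mult.commute)
qed

text \<open>Modulo the \<open>x\<^sub>j\<^sup>N\<close> the monomials \<open>x\<^sup>q\<close> with exponents below \<open>N\<close> are a \<open>T\<close>-basis of \<open>B\<close>, and the complementary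
monomials with exponents \<open>N - 1 - q\<^sub>i\<close> are the dual basis; \<open>t\<close> is the expansion of \<open>h\<close> in it.\<close>

lemma functional_eq_top_coeff:
  assumes N: "N > 0"
    and hT: "\<And>b. b \<in> P \<Longrightarrow> h b \<in> T"
    and h_add: "\<And>b c. b \<in> P \<Longrightarrow> c \<in> P \<Longrightarrow> h (b + c) = h b + h c"
    and h_mult: "\<And>y b. y \<in> T \<Longrightarrow> b \<in> P \<Longrightarrow> h (y * b) = y * h b"
    and h_xpower: "\<And>j b. j < d \<Longrightarrow> b \<in> P \<Longrightarrow> h (xpower N j * b) = 0"
    and h_deg: "\<And>i j b. b \<in> P \<Longrightarrow> bihomogeneous i j b \<Longrightarrow> bihomogeneous (i + i0) (j + j0) (h b)"
  shows "\<exists>t. t \<in> P \<and> bihomogeneous (i0 + int (d * (N - 1))) j0 t \<and> (\<forall>b\<in>P. h b = top_coeff d N (t * b))"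
proof -
  \<comment> \<open>Exponents are extensional functions, so that each monomial occurs once and \<open>Q\<close> is finite.\<close>
  define Q where "Q = ({..<d} \<rightarrow>\<^sub>E {..<N})"
  have finQ: "finite Q" by (simp add: Q_def finite_PiE)
  let ?x = "\<lambda>q. monomial (xmonomial d q) (1::'k)"
  have xP: "?x q \<in> P" for q
    unfolding P_eq using support_xmonomial by (intro monomial_mem_mpolys) blast
  define t where "t = (\<Sum>q\<in>Q. h (?x q) * ?x (\<lambda>i. N - 1 - q i))"
  have tP: "t \<in> P"
    unfolding t_def using T_subset(1) hT xP by (intro sum_mem mult_mem) auto
  have x_add: "?x q * ?x r = ?x (\<lambda>i. q i + r i)" for q r
    by (simp add: mult_single xmonomial_def sum.distrib single_add)
  have t_deg: "bihomogeneous (i0 + int (d * (N - 1))) j0 t"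
    unfolding t_def
  proof (rule bihomogeneous_sum)
    fix q assume "q \<in> Q"
    then have q: "\<And>i. i < d \<Longrightarrow> q i < N" by (auto simp: Q_def)
    have deg: "bihomogeneous (int (\<Sum>i<d. r i)) 0 (?x r)" for r
      by (auto simp: bihomogeneous_def xdeg_xmonomial ydeg_xmonomial)
    have "(\<Sum>i<d. q i) + (\<Sum>i<d. N - 1 - q i) = (\<Sum>i<d. N - 1)"
      unfolding sum.distrib[symmetric]
    proof (intro sum.cong refl)
      fix i assume "i \<in> {..<d}"
      then show "q i + (N - 1 - q i) = N - 1" using q[of i] by simp
    qed
    then have "int (\<Sum>i<d. q i) + int (\<Sum>i<d. N - 1 - q i) = int (d * (N - 1))"
      unfolding of_nat_add[symmetric] by (simp only: sum_constant card_lessThan of_nat_id)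
    then have "int (\<Sum>i<d. q i) + i0 + int (\<Sum>i<d. N - 1 - q i) = i0 + int (d * (N - 1))"
      by linarith
    then show "bihomogeneous (i0 + int (d * (N - 1))) j0 (h (?x q) * ?x (\<lambda>i. N - 1 - q i))"
      using bihomogeneous_mult[OF h_deg[OF xP deg[of q]] deg[of "\<lambda>i. N - 1 - q i"]]
      by (simp only: add_0 add_0_right)
  qed
  have x_case: "h (?x q) = top_coeff d N (t * ?x q)" for q
  proof (cases "\<forall>i<d. q i < N")
    case True
    define q' where "q' = restrict q {..<d}"
    have q': "q' \<in> Q" using True by (auto simp: q'_def Q_def)
    have xq': "?x q' = ?x q" by (simp add: xmonomial_def q'_def)
    have "top_coeff d N (t * ?x q) = (\<Sum>r\<in>Q. h (?x r) * top_coeff d N (?x (\<lambda>i. N - 1 - r i + q i)))"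
    proof -
      have "t * ?x q = (\<Sum>r\<in>Q. h (?x r) * ?x (\<lambda>i. N - 1 - r i + q i))"
        by (simp add: t_def sum_distrib_right mult.assoc x_add)
      moreover have "top_coeff d N (h (?x r) * b) = h (?x r) * top_coeff d N b" for r b
        using T_subset(2) hT[OF xP] by (intro top_coeff_mult_Y) auto
      ultimately show ?thesis by (simp add: top_coeff_sum)
    qed
    also have "\<dots> = (\<Sum>r\<in>Q. if r = q' then h (?x r) else 0)"
    proof (intro sum.cong refl)
      fix r assume r: "r \<in> Q"
      show "h (?x r) * top_coeff d N (?x (\<lambda>i. N - 1 - r i + q i)) = (if r = q' then h (?x r) else 0)"
      proof (cases "r = q'")
        case True
        have "top_coeff d N (?x (\<lambda>i. N - 1 - r i + q i)) = 1"
        proof (rule top_coeff_xmonomial)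
          fix i assume "i < d"
          then show "N - 1 - r i + q i = N - 1"
            using True \<open>\<forall>i<d. q i < N\<close> by (auto simp: q'_def)
        qed
        then show ?thesis using True by simp
      next
        case False
        have "\<exists>i<d. r i \<noteq> q i"
        proof (rule ccontr)
          assume "\<not> (\<exists>i<d. r i \<noteq> q i)"
          then have "r = q'" using r q' unfolding Q_def by (intro PiE_ext) (auto simp: q'_def)
          then show False using False by simp
        qed
        then obtain i where i: "i < d" "r i \<noteq> q i" by blast
        moreover have "r i < N" using r i by (auto simp: Q_def)
        ultimately have "top_coeff d N (?x (\<lambda>i. N - 1 - r i + q i)) = 0"
          by (intro top_coeff_eq_0) (auto simp: coeff_xmonomial_X intro!: exI[of _ i])
        then show ?thesis using False by simp
      qed
    qed
    also have "\<dots> = h (?x q)" using finQ q' xq' by (simp add: sum.delta)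
    finally show ?thesis by simp
  next
    case False
    then obtain j where j: "j < d" "N \<le> q j" by (auto simp: not_less)
    then have "\<exists>l. xmonomial d q = monomial (Xv j) N + l"
      unfolding exponent_divides_iff by (auto simp: lookup_single when_def coeff_xmonomial_X)
    then obtain l where l: "xmonomial d q = monomial (Xv j) N + l" by blast
    have "support l \<subseteq> support (xmonomial d q)" by (simp add: l support_add_exponents)
    then have lP: "monomial l 1 \<in> P"
      unfolding P_eq using support_xmonomial[of d q] by (intro monomial_mem_mpolys) blast
    have xl: "?x q = xpower N j * monomial l 1" by (simp add: l mult_single)
    have "t * ?x q = xpower N j * (t * monomial l 1)" unfolding xl by (simp add: ac_simps)
    then have "top_coeff d N (t * ?x q) = 0"
      using j tP lP N by (simp add: top_coeff_xpower_ideal xpower_in_xpower_ideal mult_mem)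
    then show ?thesis using h_xpower[OF j(1) lP] xl by simp
  qed
  have "h b = top_coeff d N (t * b)" if b: "b \<in> P" for b
  proof -
    have supp: "support m \<subseteq> Xv ` {..<d} \<union> Yv ` {..<n}" if "m \<in> support b" for m
      using b that by (auto simp: P_eq mpolys_def)
    have mon: "h (monomial m c) = top_coeff d N (t * monomial m c)" if m: "m \<in> support b" for m c
    proof -
      let ?y = "monomial (ypart m) c" and ?q = "\<lambda>i. coeff m (Xv i)"
      have yT: "?y \<in> T"
        unfolding T_eq using supp[OF m] by (intro monomial_mem_mpolys) (auto simp: support_ypart)
      have "m = ypart m + xmonomial d ?q" using supp[OF m] by (intro exponent_split) auto
      then have e: "monomial m c = ?y * ?x ?q" by (simp add: mult_single)
      have "top_coeff d N (t * (?y * ?x ?q)) = top_coeff d N (?y * (t * ?x ?q))"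
        by (simp add: ac_simps)
      also have "\<dots> = ?y * top_coeff d N (t * ?x ?q)"
        using yT T_subset(2) by (intro top_coeff_mult_Y) auto
      finally show ?thesis
        unfolding e using h_mult[OF yT xP] x_case by simp
    qed
    have "h b = (\<Sum>m\<in>support b. h (monomial m (coeff b m)))"
      by (subst monomial_expansion[of b], rule additive_sum[of h, OF h_add])
        (simp_all only: P_eq monomial_mem_mpolys supp)
    also have "\<dots> = (\<Sum>m\<in>support b. top_coeff d N (t * monomial m (coeff b m)))"
      by (intro sum.cong refl mon)
    also have "\<dots> = top_coeff d N (t * b)"
      by (simp flip: top_coeff_sum sum_distrib_left monomial_expansion)
    finally show ?thesis .
  qed
  then show ?thesis using tP t_deg by blast
qed

end

section \<open>Duality for a bihomogeneous regular sequence\<close>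

lemma bihomogeneous_unique: "bihomogeneous i j p \<Longrightarrow> bihomogeneous i' j' p \<Longrightarrow> i \<noteq> i' \<Longrightarrow> p = 0"
  by (auto simp: bihomogeneous_def simp flip: keys_eq_empty)

locale bihomogeneous_regular_sequence = xy_ring d n P T
  for d n and P T :: "'k::field mpoly set" +
  fixes f :: "nat \<Rightarrow> 'k mpoly" and \<alpha> \<beta> :: "nat \<Rightarrow> nat"
  assumes f_mem: "\<And>i. i < d \<Longrightarrow> f i \<in> P"
    and f_bihomogeneous: "\<And>i. i < d \<Longrightarrow> bihomogeneous (int (\<alpha> i)) (int (\<beta> i)) (f i)"
    and f_regular: "regular_on f 0 d"
begin

definition \<delta> :: int where "\<delta> = (\<Sum>i<d. int (\<alpha> i)) - int d"
definition \<tau> :: int where "\<tau> = (\<Sum>i<d. int (\<beta> i))"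

definition f_ideal :: "'k mpoly set" where "f_ideal = span_ideal f {0..<d}"

text \<open>The concatenated sequence: indices below \<open>d\<close> belong to \<open>f\<close>, the next \<open>d\<close> to the powers of the variables.\<close>

definition gens :: "nat \<Rightarrow> nat \<Rightarrow> 'k mpoly" where
  "gens N i = (if i < d then f i else xpower N (i - d))"

definition gens_deg :: "nat \<Rightarrow> nat \<Rightarrow> int \<times> int" where
  "gens_deg N i = (if i < d then (int (\<alpha> i), int (\<beta> i)) else (int N, 0))"

lemma component_mem_P: "p \<in> P \<Longrightarrow> component c p \<in> P"
  unfolding P_eq by (rule component_mem)

lemma gens_mem: "i < d + d \<Longrightarrow> gens N i \<in> P"
  by (auto simp: gens_def f_mem intro: xpower_mem)

lemma bihomogeneous_xpower: "bihomogeneous (int N) 0 (xpower N j)"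
proof -
  have "xdeg (monomial (Xv j) N) = N" "ydeg (monomial (Xv j) N) = 0"
    by (simp_all add: xdeg_def ydeg_def)
  then show ?thesis by (auto simp: bihomogeneous_def)
qed

lemma gens_bihomogeneous: "bihomogeneous (fst (gens_deg N i)) (snd (gens_deg N i)) (gens N i)"
  using f_bihomogeneous bihomogeneous_xpower by (auto simp: gens_def gens_deg_def)

lemma span_gens_low:
  assumes "j \<le> d"
  shows "span_ideal (gens N) {0..<j} = span_ideal f {0..<j}"
proof -
  have "(\<Sum>i\<in>{0..<j}. c i * gens N i) = (\<Sum>i\<in>{0..<j}. c i * f i)" for c
    using assms by (intro sum.cong) (auto simp: gens_def)
  then show ?thesis by (simp only: span_ideal_def)
qed

lemma span_gens_f: "span_ideal (gens N) {0..<d} = f_ideal"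
  unfolding f_ideal_def by (simp add: span_gens_low)

lemma span_gens_x: "span_ideal (gens N) {d..<d + d} = xpower_ideal N"
  by (intro span_xpowers_eq) (simp add: gens_def)

lemma regular_gens_f: "regular_on (gens N) 0 d"
  using f_regular unfolding regular_on_def by (simp add: span_gens_low gens_def)

lemma regular_gens_x: "regular_on (gens N) d d"
  by (intro regular_on_xpowers) (simp add: gens_def)

lemma ideal_in_f_ideal: "ideal_in f_ideal"
  unfolding f_ideal_def by (intro ideal_in_span_ideal f_mem) simp

lemma f_mult_mem:
  assumes "i < d" "b \<in> P"
  shows "f i * b \<in> f_ideal"
proof -
  have "f i \<in> f_ideal"
    unfolding f_ideal_def using assms(1) by (intro span_ideal_generator[of _ _ f]) auto
  then show ?thesis
    using ideal_in_mult[OF ideal_in_f_ideal assms(2)] by (subst mult.commute)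
qed

lemma component_f_ideal:
  assumes "p \<in> f_ideal"
  shows "component c p \<in> f_ideal"
proof -
  obtain g where g: "\<And>i. g i \<in> P" "p = (\<Sum>i\<in>{0..<d}. g i * f i)"
    using assms unfolding f_ideal_def by (metis span_idealE)
  have "component c (g i * f i) \<in> f_ideal" if "i < d" for i
  proof -
    have "component c (g i * f i) = f i * component (c - (int (\<alpha> i), int (\<beta> i))) (g i)"
      using component_mult[OF f_bihomogeneous[OF that], of "c - (int (\<alpha> i), int (\<beta> i))" "g i"]
      by (simp add: mult.commute)
    then show ?thesis
      using g(1)[of i] that by (simp add: f_mult_mem component_mem_P)
  qed
  then show ?thesis
    unfolding g(2) component_sum by (intro ideal_in_sum[OF ideal_in_f_ideal]) auto
qed

text \<open>The element \<open>s\<close> is the value of the cycle at the indices of the powers, so it represents torsion of \<open>S\<close>,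
and \<open>t\<close> is its value at the indices of \<open>f\<close>, so it represents a functional.\<close>

definition dual_pair :: "nat \<Rightarrow> 'k mpoly \<Rightarrow> 'k mpoly \<Rightarrow> bool" where
  "dual_pair N s t \<longleftrightarrow> koszul_linked (gens N) {d..<d + d} {0..<d} d s t"

definition x_torsion :: "nat \<Rightarrow> 'k mpoly set" where
  "x_torsion N = {s \<in> P. \<forall>j<d. xpower N j * s \<in> f_ideal}"

lemma dual_pair_exists_right:
  assumes "s \<in> x_torsion N"
  shows "\<exists>t. dual_pair N s t"
proof -
  have "\<exists>t. koszul_linked (gens N) {d..<d + d} {0..<0 + d} d s t"
  proof (rule koszul_linked_exists)
    fix j assume "j \<in> {d..<d + d}"
    then show "gens N j * s \<in> span_ideal (gens N) {0..<0 + d}"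
      using assms span_gens_f by (auto simp: x_torsion_def gens_def)
  qed (use assms regular_gens_f in \<open>auto simp: x_torsion_def intro: gens_mem\<close>)
  then show ?thesis by (simp add: dual_pair_def)
qed

lemma dual_pair_exists_left:
  assumes "t \<in> P" "\<And>i. i < d \<Longrightarrow> f i * t \<in> xpower_ideal N"
  shows "\<exists>s. dual_pair N s t"
proof -
  have "\<exists>s. koszul_linked (gens N) {0..<d} {d..<d + d} d t s"
  proof (rule koszul_linked_exists)
    fix j assume "j \<in> {0..<d}"
    then show "gens N j * t \<in> span_ideal (gens N) {d..<d + d}"
      using assms span_gens_x by (auto simp: gens_def)
  qed (use assms regular_gens_x in \<open>auto intro: gens_mem\<close>)
  then show ?thesis unfolding dual_pair_def using koszul_linked_sym by blast
qed

lemma dual_pair_right_zero: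
  assumes "dual_pair N s t" "s \<in> f_ideal"
  shows "t \<in> xpower_ideal N"
proof -
  have "t \<in> span_ideal (gens N) {d..<d + d}"
    by (rule koszul_linked_vanish[where m = 0 and p = d and s = s])
      (use assms regular_gens_f span_gens_f in \<open>auto simp: dual_pair_def intro: gens_mem\<close>)
  then show ?thesis by (simp add: span_gens_x)
qed

lemma dual_pair_left_zero:
  assumes "dual_pair N s t" "t \<in> xpower_ideal N"
  shows "s \<in> f_ideal"
proof -
  have "s \<in> span_ideal (gens N) {0..<d}"
  proof (rule koszul_linked_vanish[where m = d and p = d and s = t])
    show "koszul_linked (gens N) {0..<d} {d..<d + d} d t s"
      using assms(1) unfolding dual_pair_def by (rule koszul_linked_sym)
  qed (use assms regular_gens_x span_gens_x in \<open>auto intro: gens_mem\<close>)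
  then show ?thesis by (simp add: span_gens_f)
qed

lemma dual_pair_mem: "dual_pair N s t \<Longrightarrow> s \<in> P \<and> t \<in> P"
  unfolding dual_pair_def by (rule koszul_linked_mem)

lemma dual_pair_x_torsion:
  assumes "dual_pair N s t"
  shows "s \<in> x_torsion N"
proof -
  have "xpower N j * s \<in> f_ideal" if "j < d" for j
  proof -
    have "gens N (d + j) * s \<in> span_ideal (gens N) {0..<d}"
      by (rule koszul_linked_colon[OF assms[unfolded dual_pair_def]]) (use that in \<open>auto intro: gens_mem\<close>)
    then show ?thesis by (simp add: span_gens_f) (simp add: gens_def)
  qed
  then show ?thesis using dual_pair_mem[OF assms] by (simp add: x_torsion_def)
qed

lemma dual_pair_f_mult:
  assumes "dual_pair N s t" "i < d"
  shows "f i * t \<in> xpower_ideal N"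
proof -
  have "gens N i * t \<in> span_ideal (gens N) {d..<d + d}"
    by (rule koszul_linked_colon[OF koszul_linked_sym[OF assms(1)[unfolded dual_pair_def]]])
      (use assms(2) in \<open>auto intro: gens_mem\<close>)
  then show ?thesis using assms(2) by (simp add: span_gens_x) (simp add: gens_def)
qed

lemma dual_pair_add: "dual_pair N s t \<Longrightarrow> dual_pair N s' t' \<Longrightarrow> dual_pair N (s + s') (t + t')"
  unfolding dual_pair_def by (rule koszul_linked_add)

lemma dual_pair_diff: "dual_pair N s t \<Longrightarrow> dual_pair N s' t' \<Longrightarrow> dual_pair N (s - s') (t - t')"
  unfolding dual_pair_def by (rule koszul_linked_diff)

lemma dual_pair_mult: "dual_pair N s t \<Longrightarrow> c \<in> P \<Longrightarrow> dual_pair N (c * s) (c * t)"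
  unfolding dual_pair_def by (rule koszul_linked_mult)

text \<open>The bidegrees of the \<open>x\<^sub>j\<^sup>N\<close> add up to \<open>(d N, 0)\<close> and those of the \<open>f\<^sub>i\<close> to \<open>(\<delta> + d, \<tau>)\<close>; the difference is
written with the degree \<open>d (N - 1)\<close> of the top monomial.\<close>

lemma dual_pair_component:
  assumes "dual_pair N s t" "N > 0"
  shows "dual_pair N (component (i, j) s) (component (i + int (d * (N - 1)) - \<delta>, j - \<tau>) t)"
proof -
  have "koszul_linked (gens N) {d..<d + d} {0..<d} d (component (i, j) s)
    (component ((i, j) + sum (gens_deg N) {d..<d + d} - sum (gens_deg N) {0..<d}) t)"
  proof (rule koszul_linked_component[where K = component and deg = "gens_deg N"])
    show "component (c + gens_deg N k) (gens N k * b) = gens N k * component c b" for c k b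
      using component_mult[OF gens_bihomogeneous[of N k], of c b] by simp
  qed (use assms in \<open>auto simp: dual_pair_def component_mem_P component_add\<close>)
  moreover have "sum (gens_deg N) {d..<d + d} = (int (d * N), 0)"
  proof -
    have "sum (gens_deg N) {d..<d + d} = (\<Sum>k\<in>{d..<d + d}. (int N, 0))"
      by (intro sum.cong) (auto simp: gens_deg_def)
    then show ?thesis by (simp add: sum_prod)
  qed
  moreover have "sum (gens_deg N) {0..<d} = (\<delta> + int d, \<tau>)"
  proof -
    have "sum (gens_deg N) {0..<d} = (\<Sum>k<d. (int (\<alpha> k), int (\<beta> k)))"
      by (intro sum.cong) (auto simp: gens_deg_def)
    then show ?thesis by (simp add: sum_prod \<delta>_def \<tau>_def)
  qed
  moreover have "int (d * N) = int (d * (N - 1)) + int d"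
    using assms(2) by (cases N) (auto simp: algebra_simps)
  ultimately show ?thesis by (simp add: dual_pair_def algebra_simps)
qed

lemma x_torsion_component:
  assumes "s \<in> x_torsion N"
  shows "component c s \<in> x_torsion N"
proof -
  have "xpower N j * component c s \<in> f_ideal" if "j < d" for j
    using component_f_ideal[of "xpower N j * s" "c + (int N, 0)"] assms that
    by (simp add: component_mult[OF bihomogeneous_xpower] x_torsion_def)
  then show ?thesis using assms by (auto simp: x_torsion_def component_mem_P)
qed

text \<open>A partner \<open>t\<close> of \<open>s\<close> can be taken homogeneous of \<open>x\<close>-degree \<open>i + d (N - 1) - \<delta>\<close>. This exceeds
\<open>d (N - 1)\<close>, so \<open>t\<close> is zero modulo the powers of the variables.\<close>

lemma x_torsion_high_degree:
  assumes s: "s \<in> x_torsion N" "bihomogeneous i j s" and N: "N > 0" and i: "i > \<delta>"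
  shows "s \<in> f_ideal"
proof -
  obtain t where t: "dual_pair N s t" using dual_pair_exists_right s by blast
  let ?t = "component (i + int (d * (N - 1)) - \<delta>, j - \<tau>) t"
  have pair: "dual_pair N s ?t"
    using dual_pair_component[OF t N, of i j] component_eq_self[OF s(2)] by simp
  have "?t \<in> xpower_ideal N"
  proof (rule high_degree_in_xpower_ideal)
    fix m assume "m \<in> support ?t"
    then have "int (xdeg m) = i + int (d * (N - 1)) - \<delta>"
      using bihomogeneous_component[of "(i + int (d * (N - 1)) - \<delta>, j - \<tau>)" t] by (auto simp: bihomogeneous_def)
    then show "d * (N - 1) < xdeg m" using i by linarith
  qed (use dual_pair_mem[OF pair] in blast)
  then show ?thesis using dual_pair_left_zero pair by blast
qed

text \<open>Each component of \<open>s\<close> has \<open>x\<close>-degree at least \<open>0\<close>, so \<open>x\<^sub>j\<^sup>N\<close> moves it into \<open>x\<close>-degrees above \<open>\<delta>\<close>, where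
\<open>x_torsion_high_degree\<close> (for the exponent \<open>M\<close>) makes it vanish modulo \<open>f\<close>.\<close>

lemma x_torsion_bounded_exponent:
  assumes s: "s \<in> x_torsion M" and M: "M > 0" and N: "int N > \<delta>"
  shows "s \<in> x_torsion N"
proof -
  have sP: "s \<in> P" using s by (simp add: x_torsion_def)
  have comp: "xpower N j * component c s \<in> f_ideal" if j: "j < d" for c j
  proof (cases "fst c < 0")
    case True
    then have "component c s = 0"
      using bihomogeneous_negative[OF bihomogeneous_component] by blast
    then show ?thesis using ideal_in_zero[OF ideal_in_f_ideal] by simp
  next
    case False
    have cs: "component c s \<in> x_torsion M" using x_torsion_component s by blast
    show ?thesis
    proof (rule x_torsion_high_degree)
      show "bihomogeneous (int N + fst c) (0 + snd c) (xpower N j * component c s)"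
        by (intro bihomogeneous_mult bihomogeneous_xpower bihomogeneous_component)
      have "xpower M k * (xpower N j * component c s) \<in> f_ideal" if "k < d" for k
        using cs that j ideal_in_mult[OF ideal_in_f_ideal xpower_mem[OF j], of "xpower M k * component c s" N]
        by (simp add: x_torsion_def ac_simps)
      then show "xpower N j * component c s \<in> x_torsion M"
        using cs j by (auto simp: x_torsion_def intro: mult_mem xpower_mem)
    qed (use M N False in auto)
  qed
  have "xpower N j * s \<in> f_ideal" if "j < d" for j
  proof -
    have "xpower N j * s = (\<Sum>c\<in>(\<lambda>m. (int (xdeg m), int (ydeg m))) ` support s. xpower N j * component c s)"
      by (subst component_expansion[of s]) (simp add: sum_distrib_left)
    then show ?thesis using comp[OF that] by (simp only: ideal_in_sum[OF ideal_in_f_ideal])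
  qed
  then show ?thesis using sP by (simp add: x_torsion_def)
qed

text \<open>By this lemma and the next one, the functional \<open>b \<mapsto> top_coeff d N (t * b)\<close> depends on \<open>b\<close> and \<open>s\<close> only through
their classes modulo \<open>f\<close>.\<close>

lemma top_coeff_dual_f_ideal:
  assumes "dual_pair N s t" "N > 0" "b \<in> f_ideal"
  shows "top_coeff d N (t * b) = 0"
proof -
  obtain g where g: "\<And>i. g i \<in> P" "b = (\<Sum>i\<in>{0..<d}. g i * f i)"
    using assms(3) unfolding f_ideal_def by (metis span_idealE)
  have "t * (g i * f i) \<in> xpower_ideal N" if "i < d" for i
  proof -
    have "g i * (f i * t) \<in> xpower_ideal N"
      using assms that g by (intro ideal_in_mult[OF ideal_in_xpower_ideal] dual_pair_f_mult)
    then show ?thesis by (simp add: ac_simps)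
  qed
  then have "t * b \<in> xpower_ideal N"
    unfolding g(2) sum_distrib_left by (intro ideal_in_sum[OF ideal_in_xpower_ideal]) auto
  then show ?thesis using assms(2) by (rule top_coeff_xpower_ideal[rotated])
qed

lemma top_coeff_dual_cong:
  assumes "dual_pair N s t" "dual_pair N s' t'" "s - s' \<in> f_ideal" "b \<in> P" "N > 0"
  shows "top_coeff d N (t * b) = top_coeff d N (t' * b)"
proof -
  have "t - t' \<in> xpower_ideal N"
    using assms by (intro dual_pair_right_zero[of N "s - s'"] dual_pair_diff)
  then have "b * (t - t') \<in> xpower_ideal N"
    using assms by (intro ideal_in_mult[OF ideal_in_xpower_ideal])
  then have "top_coeff d N (t * b - t' * b) = 0"
    using assms(5) by (intro top_coeff_xpower_ideal) (auto simp: algebra_simps)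
  then show ?thesis by (simp add: top_coeff_diff)
qed

text \<open>As \<open>T\<close> sits in \<open>x\<close>-degree \<open>0\<close>, a functional of \<open>x\<close>-degree \<open>i\<^sub>0\<close> is concentrated on the elements of \<open>x\<close>-degree
\<open>- i\<^sub>0\<close>. For \<open>N > - i\<^sub>0\<close> it therefore kills the \<open>x\<^sub>j\<^sup>N\<close> and is represented by some \<open>t\<close>; since it also
kills \<open>f\<close>, this \<open>t\<close> is linked to some \<open>s\<close>.\<close>

lemma functional_dual_pair:
  assumes N: "int N > - i0" "N > 0"
    and hT: "\<And>b. b \<in> P \<Longrightarrow> h b \<in> T"
    and h_add: "\<And>b c. b \<in> P \<Longrightarrow> c \<in> P \<Longrightarrow> h (b + c) = h b + h c"
    and h_mult: "\<And>y b. y \<in> T \<Longrightarrow> b \<in> P \<Longrightarrow> h (y * b) = y * h b"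
    and h_deg: "\<And>i j b. b \<in> P \<Longrightarrow> bihomogeneous i j b \<Longrightarrow> bihomogeneous (i + i0) (j + j0) (h b)"
    and h_f: "\<And>b. b \<in> f_ideal \<Longrightarrow> h b = 0"
  shows "\<exists>s t. dual_pair N s t \<and> bihomogeneous (i0 + \<delta>) (j0 + \<tau>) s \<and> (\<forall>b\<in>P. h b = top_coeff d N (t * b))"
proof -
  have h0: "h 0 = 0" using h_add[of 0 0] zero_mem by simp
  have xdeg0: "p = 0" if "p \<in> T" "bihomogeneous i j p" "i > 0" for p i j
  proof -
    have "xdeg m = 0" if "m \<in> support p" for m
      using that \<open>p \<in> T\<close> by (intro xdeg_eq_0) (fastforce simp: T_eq mpolys_def)
    then have "bihomogeneous 0 j p"
      using that(2) by (auto simp: bihomogeneous_def)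
    then show ?thesis using bihomogeneous_unique[OF that(2)] that(3) by blast
  qed
  have h_xpower: "h (xpower N j * b) = 0" if j: "j < d" and b: "b \<in> P" for j b
  proof -
    have "h (xpower N j * component c b) = 0" for c
    proof (cases "fst c < 0")
      case True
      then have "component c b = 0"
        using bihomogeneous_negative[OF bihomogeneous_component] by blast
      then show ?thesis by (simp add: h0)
    next
      case False
      have P: "xpower N j * component c b \<in> P"
        using xpower_mem[OF j] b by (intro mult_mem component_mem_P)
      show ?thesis
        using xdeg0[OF hT[OF P] h_deg[OF P bihomogeneous_mult[OF bihomogeneous_xpower bihomogeneous_component]]]
          False N by auto
    qed
    moreover have "xpower N j * b = (\<Sum>c\<in>(\<lambda>m. (int (xdeg m), int (ydeg m))) ` support b. xpower N j * component c b)"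
      by (subst component_expansion[of b]) (simp add: sum_distrib_left)
    moreover have "xpower N j * component c b \<in> P" for c
      using xpower_mem[OF j] b by (intro mult_mem component_mem_P)
    ultimately show ?thesis by (simp add: additive_sum[of h] h_add)
  qed
  obtain t where t: "t \<in> P" "bihomogeneous (i0 + int (d * (N - 1))) j0 t"
    "\<And>b. b \<in> P \<Longrightarrow> h b = top_coeff d N (t * b)"
    using functional_eq_top_coeff[OF N(2) hT h_add h_mult h_xpower h_deg] by blast
  have "f i * t \<in> xpower_ideal N" if "i < d" for i
  proof (rule top_coeff_nondegenerate)
    fix b assume b: "b \<in> P"
    have "top_coeff d N (t * (f i * b)) = 0"
      using t(3)[of "f i * b"] h_f[OF f_mult_mem[OF that b]] f_mem[OF that] b by (simp add: mult_mem)
    then show "top_coeff d N (f i * t * b) = 0" by (simp add: ac_simps)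
  qed (use that t f_mem mult_mem in auto)
  then obtain s where s: "dual_pair N s t" using dual_pair_exists_left t(1) by blast
  have "dual_pair N (component (i0 + \<delta>, j0 + \<tau>) s) t"
    using dual_pair_component[OF s N(2), of "i0 + \<delta>" "j0 + \<tau>"] component_eq_self[OF t(2)]
    by (simp add: algebra_simps)
  moreover have "bihomogeneous (i0 + \<delta>) (j0 + \<tau>) (component (i0 + \<delta>, j0 + \<tau>) s)"
    using bihomogeneous_component[of "(i0 + \<delta>, j0 + \<tau>)" s] by simp
  ultimately show ?thesis using t(3) by blast
qed

text \<open>Here \<open>N\<close> does not depend on the degree of \<open>h\<close>. Representing \<open>h\<close> with a large exponent gives an \<open>s\<close> of
\<open>x\<close>-degree \<open>i\<^sub>0 + \<delta>\<close>. If that is negative, then \<open>s = 0\<close> and so \<open>h = 0\<close>; otherwise \<open>- i\<^sub>0 \<le> \<delta> < N\<close>.\<close>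

lemma functional_dual_pair_bounded:
  assumes N: "int N > \<delta>" "N > 0"
    and hT: "\<And>b. b \<in> P \<Longrightarrow> h b \<in> T"
    and h_add: "\<And>b c. b \<in> P \<Longrightarrow> c \<in> P \<Longrightarrow> h (b + c) = h b + h c"
    and h_mult: "\<And>y b. y \<in> T \<Longrightarrow> b \<in> P \<Longrightarrow> h (y * b) = y * h b"
    and h_deg: "\<And>i j b. b \<in> P \<Longrightarrow> bihomogeneous i j b \<Longrightarrow> bihomogeneous (i + i0) (j + j0) (h b)"
    and h_f: "\<And>b. b \<in> f_ideal \<Longrightarrow> h b = 0"
  shows "\<exists>s t. dual_pair N s t \<and> bihomogeneous (i0 + \<delta>) (j0 + \<tau>) s \<and> (\<forall>b\<in>P. h b = top_coeff d N (t * b))"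
proof (cases "i0 + \<delta> < 0")
  case False
  then show ?thesis using assms by (intro functional_dual_pair) auto
next
  case True
  have "- i0 < int (Suc (nat (- i0)))" by linarith
  then obtain s t where st: "dual_pair (Suc (nat (- i0))) s t" "bihomogeneous (i0 + \<delta>) (j0 + \<tau>) s"
    "\<And>b. b \<in> P \<Longrightarrow> h b = top_coeff d (Suc (nat (- i0))) (t * b)"
    using functional_dual_pair[of i0 "Suc (nat (- i0))" h j0, OF _ _ hT h_add h_mult h_deg h_f] by blast
  then have "s = 0" using bihomogeneous_negative True by blast
  then have t: "t \<in> xpower_ideal (Suc (nat (- i0)))"
    using dual_pair_right_zero[OF st(1)] ideal_in_zero[OF ideal_in_f_ideal] by simp
  have "h b = 0" if "b \<in> P" for b
    using st(3)[OF that] top_coeff_xpower_ideal[of "Suc (nat (- i0))" "b * t"]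
      ideal_in_mult[OF ideal_in_xpower_ideal that t] by (simp add: mult.commute)
  moreover obtain t0 where "dual_pair N 0 t0"
    using dual_pair_exists_right[of 0 N] ideal_in_zero[OF ideal_in_f_ideal] zero_mem by (auto simp: x_torsion_def)
  then have "dual_pair N (0 * 0) (0 * t0)" using zero_mem by (intro dual_pair_mult)
  ultimately show ?thesis by (intro exI[of _ 0]) auto
qed

end

section \<open>Polynomial rings and residue classes as records\<close>

lemma poly_ring_simps:
  "carrier (poly_ring V) = mpolys V" "mult (poly_ring V) = (*)" "one (poly_ring V) = 1"
  "zero (poly_ring V) = 0" "add (poly_ring V) = (+)" "smult (poly_ring V) = (*)"
  by (simp_all add: poly_ring_def)

lemma homog_poly_ring: "p \<in> homog (poly_ring V) i j \<longleftrightarrow> p \<in> mpolys V \<and> bihomogeneous i j p"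
  by (simp add: poly_ring_def bihomogeneous_def)

lemma cring_poly_ring: "cring (poly_ring V :: ('k::field mpoly, 'k mpoly) bigraded)"
proof -
  interpret P: comm_subring "mpolys V :: 'k mpoly set" by (rule comm_subring_mpolys)
  show ?thesis
  proof (rule cringI)
    show "abelian_group (poly_ring V :: ('k mpoly, 'k mpoly) bigraded)"
    proof (rule abelian_groupI)
      fix x :: "'k mpoly" assume "x \<in> carrier (poly_ring V)"
      then show "\<exists>y\<in>carrier (poly_ring V). y \<oplus>\<^bsub>poly_ring V\<^esub> x = \<zero>\<^bsub>poly_ring V\<^esub>"
        by (intro bexI[of _ "- x"]) (auto simp: poly_ring_simps P.uminus_mem)
    qed (auto simp: poly_ring_simps P.add_mem P.zero_mem add.assoc add.commute)
    show "comm_monoid (poly_ring V :: ('k mpoly, 'k mpoly) bigraded)"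
      by (rule comm_monoidI) (auto simp: poly_ring_simps P.mult_mem P.one_mem ac_simps)
  qed (auto simp: poly_ring_simps algebra_simps)
qed

lemma finsum_poly_ring:
  fixes g :: "'i \<Rightarrow> 'k::field mpoly"
  assumes "\<And>x. x \<in> D \<Longrightarrow> g x \<in> mpolys V" "finite D"
  shows "finsum (poly_ring V :: ('k mpoly, 'k mpoly) bigraded) g D = sum g D"
proof -
  interpret cring "poly_ring V :: ('k mpoly, 'k mpoly) bigraded" by (rule cring_poly_ring)
  show ?thesis
    using assms(2,1)
  proof (induction D rule: finite_induct)
    case (insert x D)
    then show ?case by (subst finsum_insert) (auto simp: poly_ring_simps)
  qed (simp add: poly_ring_simps)
qed

lemma ideal_poly_ring_iff:
  fixes J :: "'k::field mpoly set"
  shows "ideal J (poly_ring V) \<longleftrightarrow> comm_subring.ideal_in (mpolys V) J"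
proof -
  interpret P: comm_subring "mpolys V :: 'k mpoly set" by (rule comm_subring_mpolys)
  interpret R: cring "poly_ring V :: ('k mpoly, 'k mpoly) bigraded" by (rule cring_poly_ring)
  show ?thesis
  proof
    assume "ideal J (poly_ring V)"
    then interpret J: ideal J "poly_ring V :: ('k mpoly, 'k mpoly) bigraded" .
    show "P.ideal_in J"
      unfolding P.ideal_in_def
      using J.a_subset J.zero_closed J.a_closed J.I_l_closed by (auto simp: poly_ring_simps)
  next
    assume J: "P.ideal_in J"
    have right: "a * x \<in> J" if "a \<in> J" "x \<in> mpolys V" for a x
      using P.ideal_in_mult[OF J that(2,1)] by (simp only: mult.commute)
    show "ideal J (poly_ring V)"
    proof (rule idealI)
      show "subgroup J (add_monoid (poly_ring V))"
      proof (rule R.add.subgroupI)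
        fix a assume a: "a \<in> J"
        then have "a \<in> mpolys V" using P.ideal_in_subset[OF J] by blast
        then have "\<ominus>\<^bsub>poly_ring V\<^esub> a = - a"
          by (intro R.minus_equality) (auto simp: poly_ring_simps P.uminus_mem)
        then show "\<ominus>\<^bsub>poly_ring V\<^esub> a \<in> J"
          using P.ideal_in_uminus[OF J a] by simp
      qed (use P.ideal_inD[OF J] in \<open>auto simp: poly_ring_simps\<close>)
    qed (use P.ideal_inD[OF J] right R.ring_axioms in \<open>auto simp: poly_ring_simps\<close>)
  qed
qed

lemma genideal_poly_ring:
  fixes f :: "nat \<Rightarrow> 'k::field mpoly"
  assumes I: "finite I" and f: "\<And>i. i \<in> I \<Longrightarrow> f i \<in> mpolys V"
  shows "Idl\<^bsub>poly_ring V\<^esub> (f ` I) = comm_subring.span_ideal (mpolys V) f I"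
proof -
  interpret P: comm_subring "mpolys V :: 'k mpoly set" by (rule comm_subring_mpolys)
  interpret R: cring "poly_ring V :: ('k mpoly, 'k mpoly) bigraded" by (rule cring_poly_ring)
  have sub: "f ` I \<subseteq> carrier (poly_ring V)" using f by (auto simp: poly_ring_simps)
  show ?thesis
  proof
    show "Idl\<^bsub>poly_ring V\<^esub> (f ` I) \<subseteq> P.span_ideal f I"
    proof (rule R.genideal_minimal)
      show "ideal (P.span_ideal f I) (poly_ring V)"
        unfolding ideal_poly_ring_iff using f by (intro P.ideal_in_span_ideal)
      show "f ` I \<subseteq> P.span_ideal f I" using P.span_ideal_generator[OF I] by blast
    qed
    have J: "P.ideal_in (Idl\<^bsub>poly_ring V\<^esub> (f ` I))"
      using R.genideal_ideal[OF sub] unfolding ideal_poly_ring_iff .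
    show "P.span_ideal f I \<subseteq> Idl\<^bsub>poly_ring V\<^esub> (f ` I)"
    proof
      fix p assume "p \<in> P.span_ideal f I"
      then obtain c where "\<And>i. c i \<in> mpolys V" "p = (\<Sum>i\<in>I. c i * f i)" by (metis P.span_idealE)
      then show "p \<in> Idl\<^bsub>poly_ring V\<^esub> (f ` I)"
        using R.genideal_self[OF sub] by (auto intro!: P.ideal_in_sum[OF J] P.ideal_in_mult[OF J])
    qed
  qed
qed

text \<open>The coset of \<open>p\<close>, written without a ring record.\<close>

definition residue :: "'a::ab_group_add set \<Rightarrow> 'a \<Rightarrow> 'a set" where
  "residue J p = (\<lambda>j. j + p) ` J"

context comm_subring
begin

lemma mem_residue_iff: "ideal_in J \<Longrightarrow> q \<in> residue J p \<longleftrightarrow> q - p \<in> J"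
  by (auto simp: residue_def image_iff) (metis diff_add_cancel)

lemma residue_self: "ideal_in J \<Longrightarrow> p \<in> residue J p"
  by (simp add: mem_residue_iff ideal_in_zero)

lemma residue_eq_iff:
  assumes "ideal_in J"
  shows "residue J p = residue J q \<longleftrightarrow> p - q \<in> J"
proof
  assume "residue J p = residue J q"
  then show "p - q \<in> J" using residue_self[OF assms, of p] mem_residue_iff[OF assms] by blast
next
  assume pq: "p - q \<in> J"
  have "x - p \<in> J \<longleftrightarrow> x - q \<in> J" for x
    using ideal_in_add[OF assms _ pq, of "x - p"] ideal_in_diff[OF assms _ pq, of "x - q"] by auto
  then show "residue J p = residue J q" using mem_residue_iff[OF assms] by blast
qed

end

lemma r_coset_poly_ring: "J +>\<^bsub>poly_ring V\<^esub> p = residue J p"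
  by (auto simp: a_r_coset_def' residue_def poly_ring_simps)

lemma quot_poly_ring:
  fixes J :: "'k::field mpoly set"
  assumes "comm_subring.ideal_in (mpolys V) J"
  defines "A \<equiv> poly_ring V :: ('k mpoly, 'k mpoly) bigraded"
  shows "carrier (A Quot J) = residue J ` mpolys V" "zero (A Quot J) = residue J 0"
    and "p \<in> mpolys V \<Longrightarrow> q \<in> mpolys V \<Longrightarrow> residue J p \<oplus>\<^bsub>A Quot J\<^esub> residue J q = residue J (p + q)"
    and "p \<in> mpolys V \<Longrightarrow> q \<in> mpolys V \<Longrightarrow> residue J p \<otimes>\<^bsub>A Quot J\<^esub> residue J q = residue J (p * q)"
proof -
  interpret J: ideal J A using assms unfolding A_def by (simp add: ideal_poly_ring_iff)
  show "carrier (A Quot J) = residue J ` mpolys V"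
    by (auto simp: FactRing_def A_RCOSETS_def' r_coset_poly_ring[where V = V, folded A_def] A_def poly_ring_simps)
  show "zero (A Quot J) = residue J 0"
    by (simp add: FactRing_def residue_def)
  show "residue J p \<oplus>\<^bsub>A Quot J\<^esub> residue J q = residue J (p + q)"
    if "p \<in> mpolys V" "q \<in> mpolys V"
    using J.a_rcos_sum[of p q] that
    by (simp add: FactRing_def r_coset_poly_ring[where V = V, folded A_def]) (simp add: A_def poly_ring_simps r_coset_poly_ring)
  show "residue J p \<otimes>\<^bsub>A Quot J\<^esub> residue J q = residue J (p * q)"
    if "p \<in> mpolys V" "q \<in> mpolys V"
    using J.rcoset_mult_add[of p q] that
    by (simp add: FactRing_def r_coset_poly_ring[where V = V, folded A_def]) (simp add: A_def poly_ring_simps r_coset_poly_ring)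
qed

lemma regular_sequence_poly_ring:
  fixes f :: "nat \<Rightarrow> 'k::field mpoly"
  assumes "regular_sequence (poly_ring V :: ('k mpoly, 'k mpoly) bigraded) d f"
  shows "comm_subring.regular_on (mpolys V) f 0 d"
proof -
  interpret P: comm_subring "mpolys V :: 'k mpoly set" by (rule comm_subring_mpolys)
  let ?A = "poly_ring V :: ('k mpoly, 'k mpoly) bigraded"
  have f: "f i \<in> mpolys V" if "i < d" for i
    using assms that by (auto simp: regular_sequence_def poly_ring_simps)
  show ?thesis
    unfolding P.regular_on_def P.nonzerodivisor_mod_def
  proof (intro allI ballI impI)
    fix j b assume j: "j < d" and b: "b \<in> mpolys V" "f (0 + j) * b \<in> P.span_ideal f {0..<0 + j}"
    let ?J = "P.span_ideal f {0..<j}"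
    have J: "P.ideal_in ?J" using f j by (intro P.ideal_in_span_ideal) auto
    have "Idl\<^bsub>?A\<^esub> (f ` {..<j}) = ?J"
      using f j by (subst genideal_poly_ring) (auto simp: lessThan_atLeast0)
    then have "\<forall>s\<in>carrier (?A Quot ?J). (?J +>\<^bsub>?A\<^esub> f j) \<otimes>\<^bsub>?A Quot ?J\<^esub> s = \<zero>\<^bsub>?A Quot ?J\<^esub> \<longrightarrow> s = \<zero>\<^bsub>?A Quot ?J\<^esub>"
      using assms j unfolding regular_sequence_def Let_def by metis
    then have "\<forall>s\<in>carrier (?A Quot ?J). residue ?J (f j) \<otimes>\<^bsub>?A Quot ?J\<^esub> s = residue ?J 0 \<longrightarrow> s = residue ?J 0"
      by (simp only: r_coset_poly_ring quot_poly_ring(2)[OF J])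
    moreover have "residue ?J (f j) \<otimes>\<^bsub>?A Quot ?J\<^esub> residue ?J b = residue ?J 0"
      using b f[OF j] by (simp add: quot_poly_ring(4)[OF J] P.residue_eq_iff[OF J])
    ultimately have "residue ?J b = residue ?J 0"
      using b by (auto simp: quot_poly_ring(1)[OF J])
    then show "b \<in> P.span_ideal f {0..<0 + j}"
      by (simp add: P.residue_eq_iff[OF J])
  qed
qed

section \<open>Powers of the ideal of the variables\<close>

lemma x_ideal_eq:
  "(x_ideal d :: 'k::field mpoly set) =
    comm_subring.span_ideal (mpolys (Xv ` {..<d})) (\<lambda>i. monomial (monomial (Xv i) 1) 1) {..<d}"
  unfolding x_ideal_def Rx_def by (rule genideal_poly_ring) (auto intro: monomial_mem_mpolys)

text \<open>The powers of the ideal \<open>m\<close> generated by the variables are compared with the powers of the variables: \<open>m\<^sup>N\<close> contains the \<open>x\<^sub>j\<^sup>N\<close>, and its elements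
involve only monomials of degree at least \<open>N\<close>.\<close>

lemma xpower_mem_x_ideal_power:
  assumes "j < d"
  shows "(monomial (monomial (Xv j) N) 1 :: 'k::field mpoly) \<in> x_ideal d [^]\<^bsub>ideals_set (Rx d)\<^esub> (N::nat)"
proof (induction N)
  case 0
  have "(monomial (monomial (Xv j) 0) 1 :: 'k mpoly) \<in> mpolys (Xv ` {..<d})"
    using assms by (intro monomial_mem_mpolys) auto
  then show ?case by (simp add: nat_pow_def ideals_set_def Rx_def poly_ring_simps)
next
  case (Suc N)
  interpret P: comm_subring "mpolys (Xv ` {..<d}) :: 'k mpoly set" by (rule comm_subring_mpolys)
  have "(monomial (monomial (Xv j) 1) 1 :: 'k mpoly) \<in> x_ideal d"
    unfolding x_ideal_eq using assms
    by (intro P.span_ideal_generator[of _ _ "\<lambda>i. monomial (monomial (Xv i) 1) 1"]) auto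
  then have "monomial (monomial (Xv j) N) 1 * (monomial (monomial (Xv j) 1) 1 :: 'k mpoly)
      \<in> ideal_prod (Rx d) (x_ideal d [^]\<^bsub>ideals_set (Rx d)\<^esub> N) (x_ideal d)"
    using ideal_prod.prod[OF Suc, where R = "Rx d" and J = "x_ideal d"] by (simp add: Rx_def poly_ring_simps)
  moreover have "monomial (monomial (Xv j) N) 1 * (monomial (monomial (Xv j) 1) 1 :: 'k mpoly)
      = monomial (monomial (Xv j) (Suc N)) 1"
    by (simp add: mult_single flip: single_add)
  ultimately show ?case by (simp add: nat_pow_def ideals_set_def)
qed

lemma x_ideal_power_degree:
  assumes "a \<in> x_ideal d [^]\<^bsub>ideals_set (Rx d)\<^esub> (N::nat)"
  shows "a \<in> mpolys (Xv ` {..<d}) \<and> (\<forall>m\<in>support a. N \<le> xdeg m)"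
  using assms
proof (induction N arbitrary: a)
  case 0
  then show ?case by (simp add: nat_pow_def ideals_set_def Rx_def poly_ring_simps)
next
  case (Suc N)
  interpret P: comm_subring "mpolys (Xv ` {..<d}) :: 'a mpoly set" by (rule comm_subring_mpolys)
  have x: "b \<in> mpolys (Xv ` {..<d}) \<and> (\<forall>m\<in>support b. 1 \<le> xdeg m)" if b: "b \<in> x_ideal d" for b :: "'a mpoly"
  proof -
    let ?x = "\<lambda>i. monomial (monomial (Xv i) 1) 1 :: 'a mpoly"
    have "P.ideal_in (P.span_ideal ?x {..<d})"
      by (intro P.ideal_in_span_ideal monomial_mem_mpolys) auto
    then have "b \<in> mpolys (Xv ` {..<d})" using b P.ideal_in_subset unfolding x_ideal_eq by blast
    moreover obtain c where c: "b = (\<Sum>i<d. c i * ?x i)"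
      using b unfolding x_ideal_eq by (metis P.span_idealE)
    have "1 \<le> xdeg m" if m: "m \<in> support b" for m
    proof -
      obtain i where "m \<in> support (c i * ?x i)"
        using m keys_sum[of "\<lambda>i. c i * ?x i" "{..<d}"] c by auto
      then obtain k where "m = k + monomial (Xv i) 1"
        using keys_mult[of "c i" "?x i"] by auto
      moreover have "xdeg (monomial (Xv i) 1) = 1" by (simp add: xdeg_def)
      ultimately show ?thesis by (simp add: xdeg_add)
    qed
    ultimately show ?thesis by blast
  qed
  have "a \<in> ideal_prod (Rx d) (x_ideal d [^]\<^bsub>ideals_set (Rx d)\<^esub> N) (x_ideal d)"
    using Suc.prems by (simp add: nat_pow_def ideals_set_def)
  then show ?case
  proof (induction rule: ideal_prod.induct)
    case (prod b c)
    have b: "b \<in> mpolys (Xv ` {..<d})" "\<And>m. m \<in> support b \<Longrightarrow> N \<le> xdeg m" using Suc.IH[OF prod(1)] by auto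
    have c: "c \<in> mpolys (Xv ` {..<d})" "\<And>m. m \<in> support c \<Longrightarrow> 1 \<le> xdeg m" using x[OF prod(2)] by auto
    have "Suc N \<le> xdeg m" if m: "m \<in> support (b * c)" for m
    proof -
      obtain k l where "m = k + l" "k \<in> support b" "l \<in> support c"
        using m keys_mult[of b c] by blast
      then show ?thesis using b(2)[of k] c(2)[of l] by (simp add: xdeg_add)
    qed
    then show ?case using P.mult_mem[OF b(1) c(1)] by (simp add: Rx_def poly_ring_simps)
  next
    case (sum b c)
    then show ?case using keys_add[of b c] by (auto simp: Rx_def poly_ring_simps intro: P.add_mem)
  qed
qed

section \<open>The isomorphism\<close>

context bihomogeneous_regular_sequence
begin

abbreviation cls :: "'k mpoly \<Rightarrow> 'k mpoly set" where
  "cls \<equiv> residue f_ideal"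

definition S :: "('k mpoly, 'k mpoly set) bigraded" where
  "S = quot_bigraded (Bxy d n) f_ideal"

lemma carrier_Bxy: "carrier (Bxy d n) = P" and carrier_Ty: "carrier (Ty n) = T"
  by (simp_all add: Bxy_def Ty_def poly_ring_simps P_eq T_eq)

lemma ideal_in_f_ideal': "comm_subring.ideal_in (mpolys (Xv ` {..<d} \<union> Yv ` {..<n})) f_ideal"
  using ideal_in_f_ideal by (simp only: P_eq)

lemmas quot_Bxy = quot_poly_ring[OF ideal_in_f_ideal', folded Bxy_def P_eq]

lemma carrier_S: "carrier S = cls ` P"
  by (simp add: S_def quot_bigraded_def quot_Bxy)

lemma zero_S: "\<zero>\<^bsub>S\<^esub> = cls 0"
  by (simp add: S_def quot_bigraded_def quot_Bxy)

lemma add_S: "p \<in> P \<Longrightarrow> q \<in> P \<Longrightarrow> cls p \<oplus>\<^bsub>S\<^esub> cls q = cls (p + q)"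
  by (simp add: S_def quot_bigraded_def quot_Bxy)

lemma smult_S: "a \<in> P \<Longrightarrow> p \<in> P \<Longrightarrow> a \<odot>\<^bsub>S\<^esub> cls p = cls (a * p)"
  by (simp add: S_def quot_bigraded_def r_coset_poly_ring Bxy_def quot_Bxy[unfolded Bxy_def])

lemma homog_S: "homog S i j = cls ` {p \<in> P. bihomogeneous i j p}"
proof -
  have "homog (Bxy d n) i j = {p \<in> P. bihomogeneous i j p}"
    by (auto simp: Bxy_def homog_poly_ring P_eq)
  then show ?thesis
    by (simp add: S_def quot_bigraded_def) (simp add: Bxy_def r_coset_poly_ring)
qed

lemmas cls_eq_iff = residue_eq_iff[OF ideal_in_f_ideal]
lemmas mem_cls_iff = mem_residue_iff[OF ideal_in_f_ideal]

lemma x_torsion_add: "s \<in> x_torsion N \<Longrightarrow> s' \<in> x_torsion N \<Longrightarrow> s + s' \<in> x_torsion N"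
  using ideal_in_add[OF ideal_in_f_ideal] by (simp add: x_torsion_def add_mem distrib_left)

lemma x_torsion_f_ideal: "p \<in> f_ideal \<Longrightarrow> p \<in> x_torsion N"
  using ideal_in_mult[OF ideal_in_f_ideal] ideal_in_subset[OF ideal_in_f_ideal] xpower_mem
  by (auto simp: x_torsion_def)

lemma x_torsion_sum: "(\<And>c. c \<in> D \<Longrightarrow> g c \<in> x_torsion N) \<Longrightarrow> sum g D \<in> x_torsion N"
  using x_torsion_f_ideal[OF ideal_in_zero[OF ideal_in_f_ideal]]
  by (induction D rule: infinite_finite_induct) (auto intro: x_torsion_add)

lemma x_torsion_cls: "cls p = cls q \<Longrightarrow> q \<in> x_torsion N \<Longrightarrow> p \<in> x_torsion N"
  using x_torsion_add[of q N "p - q"] x_torsion_f_ideal[of "p - q" N] by (simp add: cls_eq_iff)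

text \<open>An element killed by \<open>m\<^sup>M\<close> is killed by the \<open>x\<^sub>j\<^sup>M\<close>, where the exponent can be replaced by \<open>N\<close>. Conversely, the
monomials in \<open>m\<^bsup>d(N-1)+1\<^esup>\<close> are multiples of some \<open>x\<^sub>j\<^sup>N\<close>.\<close>

lemma carrier_local_cohomology:
  assumes N: "int N > \<delta>" "N > 0"
  shows "carrier (local_cohomology0 (Rx d) (x_ideal d) S) = cls ` x_torsion N"
proof -
  let ?m = "\<lambda>M::nat. x_ideal d [^]\<^bsub>ideals_set (Rx d)\<^esub> M :: 'k mpoly set"
  have "(\<exists>M. \<forall>a\<in>?m M. a \<odot>\<^bsub>S\<^esub> cls p = \<zero>\<^bsub>S\<^esub>) \<longleftrightarrow> p \<in> x_torsion N" if p: "p \<in> P" for p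
  proof
    assume "\<exists>M. \<forall>a\<in>?m M. a \<odot>\<^bsub>S\<^esub> cls p = \<zero>\<^bsub>S\<^esub>"
    then obtain M where M: "\<And>a. a \<in> ?m M \<Longrightarrow> a \<odot>\<^bsub>S\<^esub> cls p = \<zero>\<^bsub>S\<^esub>" by blast
    \<comment> \<open>\<open>M\<close> may be \<open>0\<close>, and \<open>x_torsion_bounded_exponent\<close> starts from a positive exponent.\<close>
    have "xpower (Suc M) j * p \<in> f_ideal" if j: "j < d" for j
    proof -
      have "xpower M j * p \<in> f_ideal"
        using M[OF xpower_mem_x_ideal_power[OF j]] smult_S[OF xpower_mem[OF j] p]
        by (simp add: zero_S cls_eq_iff)
      then have "xpower 1 j * (xpower M j * p) \<in> f_ideal"
        by (rule ideal_in_mult[OF ideal_in_f_ideal xpower_mem[OF j]])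
      moreover have "xpower (Suc M) j = xpower 1 j * xpower M j"
        by (simp add: mult_single flip: single_add)
      ultimately show ?thesis by (simp only: mult.assoc)
    qed
    then have "p \<in> x_torsion (Suc M)" using p by (simp add: x_torsion_def)
    then show "p \<in> x_torsion N" by (rule x_torsion_bounded_exponent) (use N in auto)
  next
    assume tors: "p \<in> x_torsion N"
    have "a \<odot>\<^bsub>S\<^esub> cls p = \<zero>\<^bsub>S\<^esub>" if a: "a \<in> ?m (Suc (d * (N - 1)))" for a
    proof -
      have deg: "a \<in> mpolys (Xv ` {..<d})" "\<And>m. m \<in> support a \<Longrightarrow> d * (N - 1) < xdeg m"
        using x_ideal_power_degree[OF a] by (auto simp: Suc_le_eq)
      have aP: "a \<in> P" using deg(1) unfolding P_eq mpolys_def by blast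
      have "a \<in> span_ideal (xpower N) {0..<0 + d}"
        unfolding span_xpowers_eq_0 by (rule high_degree_in_xpower_ideal[OF aP deg(2)])
      then obtain c where c: "\<And>i. c i \<in> P" "a = (\<Sum>i\<in>{0..<0 + d}. c i * xpower N i)"
        by (rule span_idealE[of _ "xpower N"]) blast
      have "a * p = (\<Sum>i\<in>{0..<0 + d}. c i * (xpower N i * p))"
        by (simp add: c(2) sum_distrib_right mult.assoc)
      also have "\<dots> \<in> f_ideal"
      proof (rule ideal_in_sum[OF ideal_in_f_ideal])
        fix i assume "i \<in> {0..<0 + d}"
        then have "xpower N i * p \<in> f_ideal" using tors by (simp add: x_torsion_def)
        then show "c i * (xpower N i * p) \<in> f_ideal" by (rule ideal_in_mult[OF ideal_in_f_ideal c(1)])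
      qed
      finally show ?thesis using aP p by (simp add: smult_S zero_S cls_eq_iff)
    qed
    then show "\<exists>M. \<forall>a\<in>?m M. a \<odot>\<^bsub>S\<^esub> cls p = \<zero>\<^bsub>S\<^esub>" by blast
  qed
  moreover have "x_torsion N \<subseteq> P" by (auto simp: x_torsion_def)
  ultimately show ?thesis
    unfolding local_cohomology0_def Let_def by (auto simp: carrier_S)
qed

lemma local_cohomology_simps:
  "\<zero>\<^bsub>local_cohomology0 A J M\<^esub> = \<zero>\<^bsub>M\<^esub>" "add (local_cohomology0 A J M) = add M"
  "smult (local_cohomology0 A J M) = smult M"
  "homog (local_cohomology0 A J M) i j = homog M i j \<inter> carrier (local_cohomology0 A J M)"
  by (simp_all add: local_cohomology0_def Let_def)

text \<open>The functional attached to a class \<open>C\<close>, evaluated at a class \<open>w\<close>. The value does not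
depend on the representatives chosen, by \<open>dual_functional_eq\<close>.\<close>

definition dual_functional :: "nat \<Rightarrow> 'k mpoly set \<Rightarrow> 'k mpoly set \<Rightarrow> 'k mpoly" where
  "dual_functional N C = (\<lambda>w\<in>carrier S. top_coeff d N ((SOME t. \<exists>s\<in>C. dual_pair N s t) * (SOME b. b \<in> w)))"

lemma dual_functional_eq:
  assumes N: "N > 0" and st: "dual_pair N s t" and b: "b \<in> P"
  shows "dual_functional N (cls s) (cls b) = top_coeff d N (t * b)"
proof -
  define t' where "t' = (SOME t. \<exists>s'\<in>cls s. dual_pair N s' t)"
  define b' where "b' = (SOME b'. b' \<in> cls b)"
  have "\<exists>s'\<in>cls s. dual_pair N s' t'"
    unfolding t'_def using st residue_self[OF ideal_in_f_ideal, of s] by (intro someI[of "\<lambda>t. \<exists>s'\<in>cls s. dual_pair N s' t" t]) blast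
  then obtain s' where s': "s' - s \<in> f_ideal" "dual_pair N s' t'" by (auto simp: mem_cls_iff)
  have "b' \<in> cls b"
    unfolding b'_def using residue_self[OF ideal_in_f_ideal] by (rule someI)
  then have b': "b' - b \<in> f_ideal" by (simp add: mem_cls_iff)
  then have "b + (b' - b) \<in> P" using b ideal_in_subset[OF ideal_in_f_ideal] by (intro add_mem) auto
  then have "b' \<in> P" by simp
  then have "top_coeff d N (t' * b') = top_coeff d N (t * b')"
    using s' st N by (intro top_coeff_dual_cong)
  also have "\<dots> = top_coeff d N (t * b) + top_coeff d N (t * (b' - b))"
    by (simp flip: top_coeff_add distrib_left)
  also have "top_coeff d N (t * (b' - b)) = 0"
    using st N b' by (intro top_coeff_dual_f_ideal)
  finally show ?thesis
    using b by (simp add: dual_functional_def carrier_S t'_def b'_def)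
qed

lemma dual_functional_extensional: "dual_functional N C \<in> extensional (carrier S)"
  by (simp add: dual_functional_def)

lemma dual_functional_add:
  assumes N: "N > 0" and s: "s \<in> x_torsion N" "s' \<in> x_torsion N" and b: "b \<in> P"
  shows "dual_functional N (cls (s + s')) (cls b) = dual_functional N (cls s) (cls b) + dual_functional N (cls s') (cls b)"
proof -
  obtain t t' where t: "dual_pair N s t" "dual_pair N s' t'" using dual_pair_exists_right s by blast
  then show ?thesis
    using dual_functional_eq[OF N t(1) b] dual_functional_eq[OF N t(2) b]
      dual_functional_eq[OF N dual_pair_add[OF t] b] by (simp add: distrib_right top_coeff_add)
qed

lemma dual_functional_sum:
  assumes N: "N > 0" and s: "\<And>c. c \<in> D \<Longrightarrow> g c \<in> x_torsion N" and b: "b \<in> P"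
  shows "dual_functional N (cls (sum g D)) (cls b) = (\<Sum>c\<in>D. dual_functional N (cls (g c)) (cls b))"
proof -
  have "0 \<in> x_torsion N" by (intro x_torsion_f_ideal ideal_in_zero[OF ideal_in_f_ideal])
  then have 0: "dual_functional N (cls 0) (cls b) = 0"
    using dual_functional_add[OF N _ _ b, of 0 0] by simp
  show ?thesis
    using s
  proof (induction D rule: infinite_finite_induct)
    case (insert x D)
    then have "dual_functional N (cls (g x + sum g D)) (cls b) =
        dual_functional N (cls (g x)) (cls b) + dual_functional N (cls (sum g D)) (cls b)"
      by (intro dual_functional_add N b x_torsion_sum) auto
    then show ?case using insert by simp
  qed (simp_all add: 0)
qed

lemma dual_functional_smult:
  assumes N: "N > 0" and s: "s \<in> x_torsion N" and c: "c \<in> P" and b: "b \<in> P"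
  shows "dual_functional N (cls (c * s)) (cls b) = dual_functional N (cls s) (cls (c * b))"
proof -
  obtain t where t: "dual_pair N s t" using dual_pair_exists_right s by blast
  show ?thesis
    using dual_functional_eq[OF N t mult_mem[OF c b]] dual_functional_eq[OF N dual_pair_mult[OF t c] b]
    by (simp add: ac_simps)
qed

lemma dual_functional_bihom:
  assumes N: "N > 0" and s: "s \<in> x_torsion N" "bihomogeneous i j s"
  shows "dual_functional N (cls s) \<in> bihom_maps (Ty n) S (Ty n) (i - \<delta>) (j - \<tau>)"
proof -
  obtain t0 where t0: "dual_pair N s t0" using dual_pair_exists_right s by blast
  define t where "t = component (i + int (d * (N - 1)) - \<delta>, j - \<tau>) t0"
  have t: "dual_pair N s t"
    using dual_pair_component[OF t0 N, of i j] component_eq_self[OF s(2)] by (simp add: t_def)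
  have t_deg: "bihomogeneous (i + int (d * (N - 1)) - \<delta>) (j - \<tau>) t"
    using bihomogeneous_component[of "(i + int (d * (N - 1)) - \<delta>, j - \<tau>)" t0] by (simp add: t_def)
  have tP: "t \<in> P" using dual_pair_mem[OF t] by blast
  have val: "dual_functional N (cls s) (cls b) = top_coeff d N (t * b)" if "b \<in> P" for b
    using dual_functional_eq[OF N t that] .
  have valT: "top_coeff d N (t * b) \<in> T" if "b \<in> P" for b
    using mult_mem[OF tP that] unfolding P_eq T_eq by (rule top_coeff_mem)
  have TP: "a \<in> P" "a \<in> mpolys (range Yv)" if "a \<in> T" for a
    using that T_subset by auto
  have lin: "dual_functional N (cls s) \<in> lin_maps (Ty n) S (Ty n)"
    unfolding lin_maps_def
  proof (intro CollectI conjI ballI)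
    show "dual_functional N (cls s) \<in> carrier S \<rightarrow>\<^sub>E carrier (Ty n)"
      using dual_functional_extensional[of N "cls s"] val valT
      by (auto simp: PiE_def carrier_S carrier_Ty)
  next
    fix u v assume "u \<in> carrier S" "v \<in> carrier S"
    then obtain p q where "p \<in> P" "q \<in> P" "u = cls p" "v = cls q" by (auto simp: carrier_S)
    then show "dual_functional N (cls s) (u \<oplus>\<^bsub>S\<^esub> v) =
        dual_functional N (cls s) u \<oplus>\<^bsub>Ty n\<^esub> dual_functional N (cls s) v"
      by (simp add: add_S val add_mem distrib_left top_coeff_add Ty_def poly_ring_simps)
  next
    fix a :: "'k mpoly" and u assume "a \<in> carrier (Ty n)" "u \<in> carrier S"
    then obtain p where p: "p \<in> P" "u = cls p" and a: "a \<in> T" by (auto simp: carrier_S carrier_Ty)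
    have "top_coeff d N (a * (t * p)) = a * top_coeff d N (t * p)"
      using TP(2)[OF a] by (rule top_coeff_mult_Y)
    then have "top_coeff d N (t * (a * p)) = a * top_coeff d N (t * p)"
      by (simp add: ac_simps)
    then show "dual_functional N (cls s) (a \<odot>\<^bsub>S\<^esub> u) = a \<odot>\<^bsub>Ty n\<^esub> dual_functional N (cls s) u"
      using p TP(1)[OF a] by (simp add: smult_S val mult_mem Ty_def poly_ring_simps)
  qed
  moreover have "dual_functional N (cls s) ` homog S i' j' \<subseteq> homog (Ty n) (i' + (i - \<delta>)) (j' + (j - \<tau>))" for i' j'
  proof -
    have "dual_functional N (cls s) (cls b) \<in> homog (Ty n) (i' + (i - \<delta>)) (j' + (j - \<tau>))"
      if b: "b \<in> P" "bihomogeneous i' j' b" for b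
    proof -
      have "bihomogeneous ((i + int (d * (N - 1)) - \<delta>) + i' - int (d * (N - 1))) (j - \<tau> + j') (top_coeff d N (t * b))"
        by (intro bihomogeneous_top_coeff bihomogeneous_mult t_deg b)
      then have "bihomogeneous (i' + (i - \<delta>)) (j' + (j - \<tau>)) (top_coeff d N (t * b))"
        by (simp add: algebra_simps)
      then show ?thesis
        using val[OF b(1)] valT[OF b(1)] by (simp add: Ty_def homog_poly_ring T_eq)
    qed
    then show ?thesis by (auto simp: homog_S)
  qed
  ultimately show ?thesis by (simp add: bihom_maps_def)
qed

lemma dual_functional_surj:
  assumes N: "int N > \<delta>" "N > 0" and g: "g \<in> bihom_maps (Ty n) S (Ty n) a b"
  shows "\<exists>s\<in>x_torsion N. bihomogeneous (a + \<delta>) (b + \<tau>) s \<and> dual_functional N (cls s) = g"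
proof -
  have g_fun: "g \<in> carrier S \<rightarrow>\<^sub>E carrier (Ty n)"
    and g_add: "\<And>u v. u \<in> carrier S \<Longrightarrow> v \<in> carrier S \<Longrightarrow> g (u \<oplus>\<^bsub>S\<^esub> v) = g u + g v"
    and g_mult: "\<And>y u. y \<in> T \<Longrightarrow> u \<in> carrier S \<Longrightarrow> g (y \<odot>\<^bsub>S\<^esub> u) = y * g u"
    and g_deg: "\<And>i j. g ` homog S i j \<subseteq> homog (Ty n) (i + a) (j + b)"
    using g by (auto simp: bihom_maps_def lin_maps_def Ty_def poly_ring_simps T_eq)
  have "\<exists>s t. dual_pair N s t \<and> bihomogeneous (a + \<delta>) (b + \<tau>) s \<and> (\<forall>p\<in>P. g (cls p) = top_coeff d N (t * p))"
  proof (rule functional_dual_pair_bounded[OF N, of "\<lambda>p. g (cls p)"])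
    show "g (cls p) \<in> T" if "p \<in> P" for p
      using g_fun that by (auto simp: carrier_S carrier_Ty)
    show add: "g (cls (p + q)) = g (cls p) + g (cls q)" if "p \<in> P" "q \<in> P" for p q
      using g_add[of "cls p" "cls q"] that by (simp add: carrier_S add_S)
    show "g (cls (y * p)) = y * g (cls p)" if "y \<in> T" "p \<in> P" for y p
      using g_mult[of y "cls p"] that T_subset(1) by (auto simp: carrier_S smult_S)
    show "bihomogeneous (i + a) (j + b) (g (cls p))" if "p \<in> P" "bihomogeneous i j p" for i j p
    proof -
      have "g (cls p) \<in> homog (Ty n) (i + a) (j + b)"
        using g_deg[of i j] that unfolding homog_S by blast
      then show ?thesis by (simp add: Ty_def homog_poly_ring)
    qed
    have "g (cls 0) = 0" using add[OF zero_mem zero_mem] by simp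
    then show "g (cls p) = 0" if "p \<in> f_ideal" for p
      using that cls_eq_iff[of p 0] by simp
  qed
  then obtain s t where st: "dual_pair N s t" "bihomogeneous (a + \<delta>) (b + \<tau>) s"
    "\<And>p. p \<in> P \<Longrightarrow> g (cls p) = top_coeff d N (t * p)" by blast
  have "dual_functional N (cls s) = g"
  proof (rule extensionalityI[OF dual_functional_extensional])
    show "g \<in> extensional (carrier S)" using g_fun by (simp add: PiE_def)
    show "dual_functional N (cls s) u = g u" if "u \<in> carrier S" for u
      using that dual_functional_eq[OF N(2) st(1)] st(3) by (auto simp: carrier_S)
  qed
  then show ?thesis using st(2) dual_pair_x_torsion[OF st(1)] by blast
qed

text \<open>If \<open>t\<close> and \<open>t'\<close> define the same functional on \<open>S\<close>, they agree modulo the powers of the variables by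
nondegeneracy, and so do their partners modulo \<open>f\<close>.\<close>

lemma dual_functional_inj:
  assumes N: "N > 0" and s: "s \<in> x_torsion N" "s' \<in> x_torsion N"
    and eq: "dual_functional N (cls s) = dual_functional N (cls s')"
  shows "cls s = cls s'"
proof -
  obtain t t' where t: "dual_pair N s t" "dual_pair N s' t'" using dual_pair_exists_right s by blast
  have "t - t' \<in> xpower_ideal N"
  proof (rule top_coeff_nondegenerate)
    show "t - t' \<in> P" using dual_pair_mem t by (blast intro: diff_mem)
    show "top_coeff d N ((t - t') * b) = 0" if "b \<in> P" for b
      using dual_functional_eq[OF N t(1) that] dual_functional_eq[OF N t(2) that] eq
      by (simp add: left_diff_distrib top_coeff_diff)
  qed
  then show ?thesis
    using dual_pair_left_zero[OF dual_pair_diff[OF t]] by (simp add: cls_eq_iff)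
qed

lemma bihom_maps_values:
  assumes "g \<in> bihom_maps (Ty n) S (Ty n) a b" "u \<in> carrier S"
  shows "g u \<in> mpolys (Yv ` {..<n})"
  using assms by (auto simp: bihom_maps_def lin_maps_def Ty_def poly_ring_simps)

lemma graded_Hom_sum:
  assumes "finite D" "\<And>e. e \<in> D \<Longrightarrow> g e \<in> bihom_maps (Ty n) S (Ty n) (fst e) (snd e)"
  shows "(\<lambda>u\<in>carrier S. \<Oplus>\<^bsub>Ty n\<^esub>e\<in>D. g e u) = (\<lambda>u\<in>carrier S. \<Sum>e\<in>D. g e u)"
  using assms bihom_maps_values unfolding Ty_def
  by (intro restrict_ext finsum_poly_ring) blast+

text \<open>Both inclusions reduce to bihomogeneous elements: a sum of bihomogeneous functionals comes from the sum of
their preimages, and \<open>s\<close> is the sum of its components, whose degrees shifted by \<open>(- \<delta>, - \<tau>)\<close> form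
the index set \<open>D\<close>.\<close>

lemma carrier_graded_Hom:
  assumes N: "int N > \<delta>" "N > 0"
  shows "carrier (graded_Hom (Ty n) S (Ty n)) = dual_functional N ` cls ` x_torsion N"
proof
  show "carrier (graded_Hom (Ty n) S (Ty n)) \<subseteq> dual_functional N ` cls ` x_torsion N"
  proof
    fix h assume "h \<in> carrier (graded_Hom (Ty n) S (Ty n))"
    then obtain D g where D: "finite D" "\<And>e. e \<in> D \<Longrightarrow> g e \<in> bihom_maps (Ty n) S (Ty n) (fst e) (snd e)"
      and h: "h = (\<lambda>u\<in>carrier S. \<Oplus>\<^bsub>Ty n\<^esub>e\<in>D. g e u)"
      by (fastforce simp: graded_Hom_def)
    have "\<forall>e. \<exists>s. e \<in> D \<longrightarrow> s \<in> x_torsion N \<and> dual_functional N (cls s) = g e"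
      using dual_functional_surj[OF N D(2)] by blast
    then obtain s where s: "\<And>e. e \<in> D \<Longrightarrow> s e \<in> x_torsion N" "\<And>e. e \<in> D \<Longrightarrow> dual_functional N (cls (s e)) = g e"
      by metis
    have h': "h = (\<lambda>u\<in>carrier S. \<Sum>e\<in>D. g e u)"
      unfolding h by (rule graded_Hom_sum) (use D in auto)
    have "dual_functional N (cls (sum s D)) = h"
    proof (rule extensionalityI[OF dual_functional_extensional])
      show "h \<in> extensional (carrier S)" by (simp add: h)
      fix u assume u: "u \<in> carrier S"
      then obtain b where b: "b \<in> P" "u = cls b" by (auto simp: carrier_S)
      have "dual_functional N (cls (sum s D)) u = (\<Sum>e\<in>D. g e u)"
        unfolding b(2) using dual_functional_sum[OF N(2) _ b(1), of D s] s by simp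
      then show "dual_functional N (cls (sum s D)) u = h u"
        using u by (simp add: h')
    qed
    moreover have "sum s D \<in> x_torsion N" by (rule x_torsion_sum) (rule s(1))
    ultimately show "h \<in> dual_functional N ` cls ` x_torsion N" by blast
  qed
  show "dual_functional N ` cls ` x_torsion N \<subseteq> carrier (graded_Hom (Ty n) S (Ty n))"
  proof safe
    fix s assume s: "s \<in> x_torsion N"
    define D where "D = (\<lambda>m. (int (xdeg m) - \<delta>, int (ydeg m) - \<tau>)) ` support s"
    define g where "g e = dual_functional N (cls (component (fst e + \<delta>, snd e + \<tau>) s))" for e
    have fin: "finite D" by (simp add: D_def)
    have g: "g e \<in> bihom_maps (Ty n) S (Ty n) (fst e) (snd e)" for e
      using dual_functional_bihom[OF N(2) x_torsion_component[OF s] bihomogeneous_component, of "(fst e + \<delta>, snd e + \<tau>)"]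
      by (simp add: g_def)
    let ?C = "(\<lambda>m. (int (xdeg m), int (ydeg m))) ` support s"
    have D: "D = (\<lambda>c. (fst c - \<delta>, snd c - \<tau>)) ` ?C"
      by (simp add: D_def image_image)
    have "(\<Sum>e\<in>D. component (fst e + \<delta>, snd e + \<tau>) s) = (\<Sum>c\<in>?C. component c s)"
      unfolding D by (subst sum.reindex) (auto simp: inj_on_def)
    also have "\<dots> = s" by (rule component_expansion[symmetric])
    finally have "s = (\<Sum>e\<in>D. component (fst e + \<delta>, snd e + \<tau>) s)" by (rule sym)
    then have "dual_functional N (cls s) (cls b) = (\<Sum>e\<in>D. g e (cls b))" if "b \<in> P" for b
      using dual_functional_sum[OF N(2) x_torsion_component[OF s] that, of "\<lambda>e. (fst e + \<delta>, snd e + \<tau>)" D]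
      by (simp add: g_def)
    then have "dual_functional N (cls s) = (\<lambda>u\<in>carrier S. \<Oplus>\<^bsub>Ty n\<^esub>e\<in>D. g e u)"
      unfolding graded_Hom_sum[of D g, OF fin g]
      by (intro extensionalityI[OF dual_functional_extensional]) (auto simp: carrier_S)
    then show "dual_functional N (cls s) \<in> carrier (graded_Hom (Ty n) S (Ty n))"
      using fin g by (auto simp: graded_Hom_def intro!: exI[of _ D] exI[of _ g])
  qed
qed

lemma local_cohomology_iso:
  assumes N: "int N > \<delta>" "N > 0"
  shows "dual_functional N \<in> bihomogeneous_iso (Bxy d n)
    (local_cohomology0 (Rx d) (x_ideal d) S) (shift (- \<delta>) (- \<tau>) (graded_Hom (Ty n) S (Ty n)))"
proof -
  let ?H = "local_cohomology0 (Rx d) (x_ideal d) S" and ?E = "graded_Hom (Ty n) S (Ty n)"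
  note carrier_H = carrier_local_cohomology[OF N]
  have tP: "s \<in> P" if "s \<in> x_torsion N" for s using that by (simp add: x_torsion_def)
  have "dual_functional N \<in> iso (add_monoid ?H) (add_monoid (shift (- \<delta>) (- \<tau>) ?E))"
  proof (rule isoI)
    show "dual_functional N \<in> hom (add_monoid ?H) (add_monoid (shift (- \<delta>) (- \<tau>) ?E))"
    proof (rule homI)
      fix C assume "C \<in> carrier (add_monoid ?H)"
      then show "dual_functional N C \<in> carrier (add_monoid (shift (- \<delta>) (- \<tau>) ?E))"
        using carrier_H carrier_graded_Hom[OF N] by (auto simp: shift_def)
    next
      fix C C' assume "C \<in> carrier (add_monoid ?H)" "C' \<in> carrier (add_monoid ?H)"
      then obtain s s' where s: "s \<in> x_torsion N" "s' \<in> x_torsion N" "C = cls s" "C' = cls s'"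
        using carrier_H by auto
      have "dual_functional N (cls (s + s')) =
          (\<lambda>u\<in>carrier S. dual_functional N (cls s) u \<oplus>\<^bsub>Ty n\<^esub> dual_functional N (cls s') u)"
        using dual_functional_add[OF N(2) s(1,2)]
        by (intro extensionalityI[OF dual_functional_extensional])
          (auto simp: carrier_S Ty_def poly_ring_simps)
      then show "dual_functional N (C \<otimes>\<^bsub>add_monoid ?H\<^esub> C') =
          dual_functional N C \<otimes>\<^bsub>add_monoid (shift (- \<delta>) (- \<tau>) ?E)\<^esub> dual_functional N C'"
        using s tP by (simp add: local_cohomology_simps add_S shift_def graded_Hom_def)
    qed
    show "bij_betw (dual_functional N) (carrier (add_monoid ?H)) (carrier (add_monoid (shift (- \<delta>) (- \<tau>) ?E)))"
      using carrier_H carrier_graded_Hom[OF N] dual_functional_inj[OF N(2)]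
      by (auto simp: bij_betw_def shift_def inj_on_def)
  qed
  moreover have "dual_functional N (c \<odot>\<^bsub>?H\<^esub> C) = c \<odot>\<^bsub>shift (- \<delta>) (- \<tau>) ?E\<^esub> dual_functional N C"
    if c': "c \<in> carrier (Bxy d n)" and C: "C \<in> carrier ?H" for c C
  proof -
    obtain s where s: "s \<in> x_torsion N" "C = cls s" using C carrier_H by auto
    have c: "c \<in> P" using c' by (simp add: carrier_Bxy)
    have "dual_functional N (cls (c * s)) = (\<lambda>u\<in>carrier S. dual_functional N (cls s) (c \<odot>\<^bsub>S\<^esub> u))"
      using dual_functional_smult[OF N(2) s(1) c]
      by (intro extensionalityI[OF dual_functional_extensional]) (auto simp: carrier_S smult_S c)
    then show ?thesis
      using s c tP by (simp add: local_cohomology_simps smult_S shift_def graded_Hom_def)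
  qed
  moreover have "dual_functional N ` homog ?H i j = homog (shift (- \<delta>) (- \<tau>) ?E) i j" for i j
  proof -
    have E: "homog (shift (- \<delta>) (- \<tau>) ?E) i j = bihom_maps (Ty n) S (Ty n) (i - \<delta>) (j - \<tau>)"
      by (simp add: shift_def graded_Hom_def)
    have H: "homog ?H i j = cls ` {s \<in> x_torsion N. bihomogeneous i j s}"
    proof
      show "homog ?H i j \<subseteq> cls ` {s \<in> x_torsion N. bihomogeneous i j s}"
        unfolding local_cohomology_simps homog_S carrier_H using x_torsion_cls by blast
      show "cls ` {s \<in> x_torsion N. bihomogeneous i j s} \<subseteq> homog ?H i j"
        unfolding local_cohomology_simps homog_S carrier_H using tP by blast
    qed
    show ?thesis
      unfolding H E
    proof
      show "dual_functional N ` cls ` {s \<in> x_torsion N. bihomogeneous i j s} \<subseteq> bihom_maps (Ty n) S (Ty n) (i - \<delta>) (j - \<tau>)"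
        using dual_functional_bihom[OF N(2)] by blast
      show "bihom_maps (Ty n) S (Ty n) (i - \<delta>) (j - \<tau>) \<subseteq> dual_functional N ` cls ` {s \<in> x_torsion N. bihomogeneous i j s}"
        using dual_functional_surj[OF N, of _ "i - \<delta>" "j - \<tau>"] by fastforce
    qed
  qed
  ultimately show ?thesis by (simp add: bihomogeneous_iso_def)
qed

end

theorem theorem1:
  fixes d n :: nat
    and f :: "nat \<Rightarrow> 'k::field mpoly"
    and \<alpha> \<beta> :: "nat \<Rightarrow> nat"
    and S :: "('k mpoly, 'k mpoly set) bigraded"
    and \<delta> \<tau> :: int
  assumes f_in: "\<And>i. i < d \<Longrightarrow> f i \<in> Idl\<^bsub>Bxy d n\<^esub> (x_ideal d)"
    and f_bideg: "\<And>i. i < d \<Longrightarrow> f i \<in> homog (Bxy d n) (int (\<alpha> i)) (int (\<beta> i))"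
    and f_reg: "regular_sequence (Bxy d n) d f"
    and S_eq: "S = quot_bigraded (Bxy d n) (Idl\<^bsub>Bxy d n\<^esub> (f ` {..<d}))"
    and \<delta>_eq: "\<delta> = (\<Sum>i<d. int (\<alpha> i)) - int d"
    and \<tau>_eq: "\<tau> = (\<Sum>i<d. int (\<beta> i))"
  shows "\<exists>\<phi>. \<phi> \<in> bihomogeneous_iso (Bxy d n)
                 (local_cohomology0 (Rx d) (x_ideal d) S)
                 (shift (- \<delta>) (- \<tau>) (graded_Hom (Ty n) S (Ty n)))"
proof -
  let ?P = "mpolys (Xv ` {..<d} \<union> Yv ` {..<n}) :: 'k mpoly set"
  interpret R: xy_ring d n ?P "mpolys (Yv ` {..<n})" by unfold_locales auto
  interpret F: bihomogeneous_regular_sequence d n ?P "mpolys (Yv ` {..<n})" f \<alpha> \<beta>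
  proof
    show "f i \<in> ?P" "bihomogeneous (int (\<alpha> i)) (int (\<beta> i)) (f i)" if "i < d" for i
      using f_bideg[OF that] by (auto simp: Bxy_def homog_poly_ring)
    show "R.regular_on f 0 d"
      using f_reg unfolding Bxy_def by (rule regular_sequence_poly_ring)
  qed
  have "Idl\<^bsub>Bxy d n\<^esub> (f ` {..<d}) = F.f_ideal"
    using F.f_mem unfolding Bxy_def F.f_ideal_def lessThan_atLeast0[symmetric] by (intro genideal_poly_ring) auto
  then have "S = F.S" by (simp add: S_eq F.S_def)
  moreover have "\<delta> = F.\<delta>" "\<tau> = F.\<tau>" by (simp_all add: \<delta>_eq \<tau>_eq F.\<delta>_def F.\<tau>_def)
  \<comment> \<open>The exponent is the least positive one above \<open>\<delta>\<close>.\<close>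
  moreover have "F.dual_functional (Suc (nat F.\<delta>)) \<in> bihomogeneous_iso (Bxy d n)
      (local_cohomology0 (Rx d) (x_ideal d) F.S) (shift (- F.\<delta>) (- F.\<tau>) (graded_Hom (Ty n) F.S (Ty n)))"
    by (rule F.local_cohomology_iso) linarith+
  ultimately show ?thesis by blast
qed

end
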